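(* Let $1<p<\infty$ and let $I$ be an ideal in $H^\infty$. Then $I$ is the trace of an ideal $J$ in $N^p$ (i.e. $I=J\cap H^\infty$ for some ideal $J$ of $N^p$) if and only if the following condition is satisfied: whenever $f\in I$, $F$ is an outer function with $\log|F^*|\in L^p(T)$, and $fF\in H^\infty$, then $fF\in I$. In this case, $J$ is the unique ideal in $N^p$ with $I=J\cap H^\infty$, and $J=IN^p$.
   Context: $D$ is the open unit disk in $\mathbb{C}$, $T=\partial D$. $H^\infty$ is the ring of bounded holomorphic functions on $D$. For $1<p<\infty$, $N^p$ is the ring (under pointwise operations) of holomorphic $f$ on $D$ with $\sup_{0<r<1}\int_0^{2\pi}\big(\log^+|f(re^{i\theta})|\big)^p\,\frac{d\theta}{2\pi}<\infty$, where $\log^+ x=\max(\log x,0)$ for $x\ge 0$ (so $\log^+0=0$); it contains $H^\infty$. $F^*(e^{i\theta})=\lim_{r\to1}F(re^{i\theta})$ denotes the radial boundary function (defined a.e.). An outer function is a holomorphic function on $D$ of the form $F(z)=\lambda\exp\Big(\frac1{2\pi}\int_0^{2\pi}\frac{e^{it}+z}{e^{it}-z}\log|F^*(e^{it})|\,dt\Big)$ with $|\lambda|=1$ and $\log|F^*|\in L^1(T)$. $IN^p$ denotes the ideal of $N^p$ generated by $I$. *)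

theory Defs
  imports "HOL-Complex_Analysis.Complex_Analysis" "HOL-Algebra.Ideal"
begin

abbreviation unit_disc :: "complex set"
  where "unit_disc \<equiv> ball 0 1"

text \<open>
  The circle is parametrized by \<open>t \<mapsto> cis t\<close> on \<open>[0, 2\<pi>]\<close>; the measure is not normalized, so the
  factor \<open>1 / (2\<pi>)\<close> is written out where it matters.
\<close>

abbreviation circle_measure :: "real measure"
  where "circle_measure \<equiv> lebesgue_on {0..2*pi}"

text \<open>
  A function on the disc is represented by its extension with value \<open>undefined\<close> outside the disc,
  so that equality in the ring is equality of functions on the disc, and rings of functions on the
  disc sit inside each other as sets.
\<close>

definition disc_fun_ring :: "(complex \<Rightarrow> complex) set \<Rightarrow> (complex \<Rightarrow> complex) ring"
  where "disc_fun_ring S =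
    \<lparr>carrier = S \<inter> extensional unit_disc,
     mult = (\<lambda>f g. \<lambda>z\<in>unit_disc. f z * g z),
     one = (\<lambda>z\<in>unit_disc. 1),
     zero = (\<lambda>z\<in>unit_disc. 0),
     add = (\<lambda>f g. \<lambda>z\<in>unit_disc. f z + g z)\<rparr>"

definition H_infinity :: "(complex \<Rightarrow> complex) ring"
  where "H_infinity = disc_fun_ring {f. f holomorphic_on unit_disc \<and> bounded (f ` unit_disc)}"

text \<open>Since \<open>ln 0 = 0\<close>, this gives \<open>log_plus 0 = 0\<close>.\<close>

definition log_plus :: "real \<Rightarrow> real"
  where "log_plus x = max (ln x) 0"

definition N_ring :: "real \<Rightarrow> (complex \<Rightarrow> complex) ring"
  where "N_ring p = disc_fun_ring {f. f holomorphic_on unit_disc \<and>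
    (SUP r\<in>{0<..<1}. \<integral>\<^sup>+ t. ennreal (log_plus (cmod (f (complex_of_real r * cis t))) powr p / (2*pi))
       \<partial>circle_measure) < \<infinity>}"

definition radial_boundary :: "(complex \<Rightarrow> complex) \<Rightarrow> real \<Rightarrow> complex"
  where "radial_boundary F t = Lim (at_left 1) (\<lambda>r. F (complex_of_real r * cis t))"

definition in_Lp :: "real \<Rightarrow> 'a measure \<Rightarrow> ('a \<Rightarrow> real) \<Rightarrow> bool"
  where "in_Lp p M u \<longleftrightarrow> u \<in> borel_measurable M \<and> integrable M (\<lambda>x. \<bar>u x\<bar> powr p)"

text \<open>
  The almost everywhere condition says that the boundary function is defined almost everywhere and
  that its logarithmic modulus is almost everywhere finite. It has to be explicit because \<open>Lim\<close> is
  total and \<open>ln 0 = 0\<close>.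
\<close>

definition outer_function :: "(complex \<Rightarrow> complex) \<Rightarrow> bool"
  where "outer_function F \<longleftrightarrow>
    F holomorphic_on unit_disc \<and>
    (AE t in circle_measure.
       \<exists>l. l \<noteq> 0 \<and> ((\<lambda>r. F (complex_of_real r * cis t)) \<longlongrightarrow> l) (at_left 1)) \<and>
    in_Lp 1 circle_measure (\<lambda>t. ln (cmod (radial_boundary F t))) \<and>
    (\<exists>c. cmod c = 1 \<and>
      (\<forall>z\<in>unit_disc. F z = c * exp (1 / (2 * complex_of_real pi) *
         (LINT t|circle_measure.
            (cis t + z) / (cis t - z) * complex_of_real (ln (cmod (radial_boundary F t)))))))"

lemma cring_disc_fun_ring:
  assumes hol: "\<And>f. f \<in> S \<Longrightarrow> f holomorphic_on unit_disc"
    and cong: "\<And>f g. f \<in> S \<Longrightarrow> (\<And>z. z \<in> unit_disc \<Longrightarrow> f z = g z) \<Longrightarrow> g \<in> S"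
    and const: "\<And>c. (\<lambda>_. c) \<in> S"
    and add: "\<And>f g. f \<in> S \<Longrightarrow> g \<in> S \<Longrightarrow> (\<lambda>z. f z + g z) \<in> S"
    and mult: "\<And>f g. f \<in> S \<Longrightarrow> g \<in> S \<Longrightarrow> (\<lambda>z. f z * g z) \<in> S"
  shows "cring (disc_fun_ring S)"
proof (rule cringI)
  let ?R = "disc_fun_ring S"
  have rS: "(\<lambda>z\<in>unit_disc. f z) \<in> S" if "f \<in> S" for f
    using that by (rule cong) simp
  show "abelian_group ?R"
  proof (rule abelian_groupI)
    fix f assume f: "f \<in> carrier ?R"
    have "(\<lambda>z\<in>unit_disc. (-1) * f z) \<in> S"
      using f const[of "-1"] by (intro rS mult) (auto simp: disc_fun_ring_def)
    then show "\<exists>g\<in>carrier ?R. g \<oplus>\<^bsub>?R\<^esub> f = \<zero>\<^bsub>?R\<^esub>"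
      by (intro bexI[of _ "\<lambda>z\<in>unit_disc. (-1) * f z"]) (auto simp: disc_fun_ring_def)
  qed (use rS add const in \<open>auto simp: disc_fun_ring_def fun_eq_iff add_ac restrict_def extensional_def\<close>)
  show "comm_monoid ?R"
    by (rule comm_monoidI)
      (use rS mult const in \<open>auto simp: disc_fun_ring_def fun_eq_iff mult_ac restrict_def extensional_def\<close>)
qed (auto simp: disc_fun_ring_def restrict_def fun_eq_iff algebra_simps)

lemma cring_H_infinity: "cring H_infinity"
  unfolding H_infinity_def
proof (rule cring_disc_fun_ring, goal_cases)
  case (2 f g)
  then have "f ` unit_disc = g ` unit_disc" by (intro image_cong) auto
  moreover have "g holomorphic_on unit_disc"
    using 2 holomorphic_cong[of unit_disc unit_disc f g] by simp
  ultimately show ?case using 2 by simp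
next
  case (4 f g)
  then show ?case by (auto intro!: holomorphic_intros bounded_plus_comp)
next
  case (5 f g)
  then obtain a b where "\<And>z. z \<in> unit_disc \<Longrightarrow> cmod (f z) \<le> a" "\<And>z. z \<in> unit_disc \<Longrightarrow> cmod (g z) \<le> b"
    unfolding bounded_iff mem_Collect_eq ball_simps by blast
  then have "cmod (f z * g z) \<le> a * b" if "z \<in> unit_disc" for z
    using that by (smt (verit) norm_ge_zero norm_mult mult_mono)
  then have "bounded ((\<lambda>z. f z * g z) ` unit_disc)" by (intro boundedI) blast
  with 5 show ?case by (auto intro!: holomorphic_intros)
qed (auto simp: bounded_iff)

lemma log_plus_nonneg: "0 \<le> log_plus x"
  by (simp add: log_plus_def)

lemma log_plus_mono: "0 \<le> x \<Longrightarrow> x \<le> y \<Longrightarrow> log_plus x \<le> log_plus y"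
  by (cases "x = 0") (auto simp: log_plus_def max_def)

lemma log_plus_mult: "0 \<le> x \<Longrightarrow> 0 \<le> y \<Longrightarrow> log_plus (x * y) \<le> log_plus x + log_plus y"
  by (cases "x = 0 \<or> y = 0") (auto simp: log_plus_def ln_mult)

lemma log_plus_add:
  assumes "0 \<le> x" "0 \<le> y"
  shows "log_plus (x + y) \<le> 1 + log_plus x + log_plus y"
proof -
  have "log_plus (x + y) \<le> log_plus (2 * max x y)"
    using assms by (intro log_plus_mono) auto
  also have "\<dots> \<le> log_plus 2 + log_plus (max x y)"
    using assms by (intro log_plus_mult) auto
  also have "log_plus 2 \<le> 1"
    using ln_le_minus_one[of 2] by (simp add: log_plus_def)
  finally show ?thesis
    using log_plus_nonneg[of x] log_plus_nonneg[of y] by (auto simp: max_def split: if_splits)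
qed

lemma powr_sum3_le:
  fixes a b :: real
  assumes "0 \<le> a" "0 \<le> b" "0 \<le> c" "c \<le> 1 + a + b" "0 \<le> p"
  shows "c powr p \<le> 3 powr p * (1 + a powr p + b powr p)"
proof -
  define m where "m = max 1 (max a b)"
  have m: "m powr p \<le> 1 + a powr p + b powr p" by (auto simp: m_def max_def)
  have "c powr p \<le> (3 * m) powr p" using assms by (intro powr_mono2) (auto simp: m_def)
  also have "\<dots> = 3 powr p * m powr p" using assms by (subst powr_mult) (auto simp: m_def)
  also have "\<dots> \<le> 3 powr p * (1 + a powr p + b powr p)" using m by (intro mult_left_mono) auto
  finally show ?thesis .
qed

lemma N_ring_measurable:
  assumes "f holomorphic_on unit_disc" "0 < r" "r < 1"
  shows "(\<lambda>t. log_plus (cmod (f (complex_of_real r * cis t))) powr p / (2*pi))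
    \<in> borel_measurable circle_measure"
proof -
  have "continuous_on {0..2*pi} (\<lambda>t. f (complex_of_real r * cis t))"
    using assms by (intro continuous_on_compose2[OF holomorphic_on_imp_continuous_on[OF assms(1)]]
        continuous_intros) (auto simp: norm_mult)
  then have [measurable]: "(\<lambda>t. f (complex_of_real r * cis t)) \<in> borel_measurable circle_measure"
    by (intro continuous_imp_measurable_on_sets_lebesgue) auto
  show ?thesis unfolding log_plus_def by measurable
qed

lemma N_bound:
  fixes p :: real
  assumes f: "f holomorphic_on unit_disc" and g: "g holomorphic_on unit_disc" and p: "0 \<le> p"
    and le: "\<And>z. z \<in> unit_disc \<Longrightarrow>
      log_plus (cmod (h z)) \<le> 1 + log_plus (cmod (f z)) + log_plus (cmod (g z))"
    and "(SUP r\<in>{0<..<1}. \<integral>\<^sup>+ t. ennreal (log_plus (cmod (f (complex_of_real r * cis t))) powr p / (2*pi))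
       \<partial>circle_measure) < \<infinity>" (is "?A < _")
    and "(SUP r\<in>{0<..<1}. \<integral>\<^sup>+ t. ennreal (log_plus (cmod (g (complex_of_real r * cis t))) powr p / (2*pi))
       \<partial>circle_measure) < \<infinity>" (is "?B < _")
  shows "(SUP r\<in>{0<..<1}. \<integral>\<^sup>+ t. ennreal (log_plus (cmod (h (complex_of_real r * cis t))) powr p / (2*pi))
       \<partial>circle_measure) < \<infinity>"
proof -
  let ?K = "ennreal (3 powr p)"
  let ?c = "\<integral>\<^sup>+ t. ennreal (1 / (2*pi)) \<partial>circle_measure"
  let ?L = "\<lambda>f r t. log_plus (cmod (f (complex_of_real r * cis t))) powr p / (2*pi)"
  have "(\<integral>\<^sup>+ t. ennreal (?L h r t) \<partial>circle_measure) \<le> ?K * (?c + ?A + ?B)" if r: "r \<in> {0<..<1}" for r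
  proof -
    have [measurable]: "?L f r \<in> borel_measurable circle_measure" "?L g r \<in> borel_measurable circle_measure"
      using r by (auto intro!: N_ring_measurable f g)
    have "ennreal (?L h r t) \<le> ?K * (ennreal (1 / (2*pi)) + ennreal (?L f r t) + ennreal (?L g r t))" for t
    proof -
      have "complex_of_real r * cis t \<in> unit_disc" using r by (auto simp: norm_mult)
      from powr_sum3_le[OF log_plus_nonneg log_plus_nonneg log_plus_nonneg le[OF this] p]
      have "?L h r t \<le> 3 powr p * (1 / (2*pi) + ?L f r t + ?L g r t)"
        by (simp add: field_simps)
      then have "ennreal (?L h r t) \<le> ennreal (3 powr p * (1 / (2*pi) + ?L f r t + ?L g r t))"
        by (rule ennreal_leI)
      also have "\<dots> = ?K * (ennreal (1 / (2*pi)) + ennreal (?L f r t) + ennreal (?L g r t))"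
        by (simp add: ennreal_mult' flip: ennreal_plus)
      finally show ?thesis .
    qed
    then have "(\<integral>\<^sup>+ t. ennreal (?L h r t) \<partial>circle_measure) \<le>
        (\<integral>\<^sup>+ t. ?K * (ennreal (1 / (2*pi)) + ennreal (?L f r t) + ennreal (?L g r t)) \<partial>circle_measure)"
      by (intro nn_integral_mono)
    also have "\<dots> = ?K * (?c + (\<integral>\<^sup>+ t. ennreal (?L f r t) \<partial>circle_measure)
        + (\<integral>\<^sup>+ t. ennreal (?L g r t) \<partial>circle_measure))"
      by (simp add: nn_integral_cmult nn_integral_add del: nn_integral_const)
    also have "\<dots> \<le> ?K * (?c + ?A + ?B)"
      using r by (intro mult_left_mono add_mono order_refl SUP_upper) auto
    finally show ?thesis .
  qed
  then have "(SUP r\<in>{0<..<1}. \<integral>\<^sup>+ t. ennreal (?L h r t) \<partial>circle_measure) \<le> ?K * (?c + ?A + ?B)"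
    by (rule SUP_least)
  also have "\<dots> < \<infinity>"
    using assms(5,6)
    by (simp add: ennreal_mult_less_top emeasure_restrict_space ennreal_mult_eq_top_iff less_top)
  finally show ?thesis .
qed

lemma N_const:
  fixes p :: real
  assumes "\<And>z. z \<in> unit_disc \<Longrightarrow> cmod (f z) \<le> M" "0 \<le> p"
  shows "(SUP r\<in>{0<..<1}. \<integral>\<^sup>+ t. ennreal (log_plus (cmod (f (complex_of_real r * cis t))) powr p / (2*pi))
       \<partial>circle_measure) < \<infinity>"
proof -
  have "(SUP r\<in>{0<..<1}. \<integral>\<^sup>+ t. ennreal (log_plus (cmod (f (complex_of_real r * cis t))) powr p / (2*pi))
       \<partial>circle_measure) \<le> (\<integral>\<^sup>+ t. ennreal (log_plus M powr p / (2*pi)) \<partial>circle_measure)"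
    using assms by (intro SUP_least nn_integral_mono ennreal_leI divide_right_mono powr_mono2
        log_plus_mono log_plus_nonneg) (auto simp: norm_mult)
  also have "\<dots> < \<infinity>"
    by (simp add: emeasure_restrict_space ennreal_mult_less_top)
  finally show ?thesis .
qed

lemma cring_N_ring:
  assumes p: "1 < p"
  shows "cring (N_ring p)"
  unfolding N_ring_def
proof (rule cring_disc_fun_ring, goal_cases)
  case (2 f g)
  have "complex_of_real r * cis t \<in> unit_disc" if "r \<in> {0<..<1}" for r t
    using that by (auto simp: norm_mult)
  with 2 have "f (complex_of_real r * cis t) = g (complex_of_real r * cis t)"
    if "r \<in> {0<..<1}" for r t using that by blast
  moreover have "g holomorphic_on unit_disc"
    using 2 holomorphic_cong[of unit_disc unit_disc f g] by simp
  ultimately show ?case using 2 by simp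
next
  case (3 c)
  show ?case using N_const[of "\<lambda>_. c" "cmod c" p] p by simp
next
  case (4 f g)
  have "log_plus (cmod (f z + g z)) \<le> 1 + log_plus (cmod (f z)) + log_plus (cmod (g z))" for z
    using log_plus_mono[OF norm_ge_zero norm_triangle_ineq[of "f z" "g z"]]
      log_plus_add[of "cmod (f z)" "cmod (g z)"] by simp
  with 4 N_bound[of f g p "\<lambda>z. f z + g z"] p show ?case by (auto intro!: holomorphic_intros)
next
  case (5 f g)
  have "log_plus (cmod (f z * g z)) \<le> 1 + log_plus (cmod (f z)) + log_plus (cmod (g z))" for z
    using log_plus_mult[of "cmod (f z)" "cmod (g z)"] by (simp add: norm_mult)
  with 5 N_bound[of f g p "\<lambda>z. f z * g z"] p show ?case by (auto intro!: holomorphic_intros)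
qed auto

lemma carrier_H_infinity_subset_N_ring:
  assumes "1 < p"
  shows "carrier H_infinity \<subseteq> carrier (N_ring p)"
proof
  fix f assume f: "f \<in> carrier H_infinity"
  then obtain M where "\<And>z. z \<in> unit_disc \<Longrightarrow> cmod (f z) \<le> M"
    by (force simp: H_infinity_def disc_fun_ring_def bounded_iff)
  from N_const[where p = p, OF this] f assms show "f \<in> carrier (N_ring p)"
    by (simp add: H_infinity_def N_ring_def disc_fun_ring_def)
qed

end

theory Submission
  imports Defs
begin

text \<open>
  One analytic fact carries the theorem: every \<open>f\<close> in \<open>N\<^sup>p\<close> is dominated by an outer function that is
  invertible in \<open>N\<^sup>p\<close>. Call a holomorphic \<open>G\<close> on the disc \<open>L\<^sup>p\<close>-positive if \<open>Re G \<ge> 0\<close> and the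
  integrals of \<open>(Re G)\<^sup>p\<close> over the circles of radius \<open>r < 1\<close> are bounded. Then

  \<^item> for \<open>f\<close> in \<open>N\<^sup>p\<close> some \<open>L\<^sup>p\<close>-positive \<open>G\<close> has \<open>\<bar>f\<bar> \<le> exp (Re G)\<close> (\<open>N_ring_majorant\<close>);

  \<^item> for \<open>L\<^sup>p\<close>-positive \<open>G\<close> the function \<open>exp G\<close> is outer, with logarithmic boundary modulus in \<open>L\<^sup>p\<close>
    (\<open>exp_outer_function\<close>);

  \<^item> outer functions with logarithmic boundary modulus in \<open>L\<^sup>p\<close> belong to \<open>N\<^sup>p\<close>
    (\<open>outer_function_in_N_ring\<close>).

  Hence each \<open>f\<close> in \<open>N\<^sup>p\<close> is \<open>a \<cdot> exp G\<close> with \<open>a = f \<cdot> exp (-G)\<close> in \<open>H\<^sup>\<infinity>\<close>, where \<open>exp (-G)\<close> is in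
  \<open>H\<^sup>\<infinity>\<close> and \<open>exp G\<close> in \<open>N\<^sup>p\<close>: the ring \<open>N\<^sup>p\<close> consists of fractions over \<open>H\<^sup>\<infinity>\<close>. The rest is the
  algebra of ideals under such an extension. An ideal \<open>J\<close> of \<open>N\<^sup>p\<close> is generated by its trace, because
  \<open>f\<close> in \<open>J\<close> gives \<open>a = f \<cdot> exp (-G)\<close> in the trace; this is uniqueness and \<open>J = I N\<^sup>p\<close>. The condition on \<open>I\<close> is
  necessary because the outer functions in question are elements of \<open>N\<^sup>p\<close>. It is sufficient because
  the products \<open>f \<cdot> exp G\<close> with \<open>f\<close> in \<open>I\<close> already form an ideal of \<open>N\<^sup>p\<close>: a sum of two such products has the
  common denominator \<open>exp (-G - H)\<close>. The condition says that these products contribute nothing new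
  to \<open>H\<^sup>\<infinity>\<close>.

  For the majorant, \<open>log\<^sup>+ \<bar>f\<bar>\<close> is replaced on the circle of radius \<open>r\<close> by its Poisson integral, which
  dominates it inside because it is subharmonic; the corresponding functions \<open>exp (-G\<^sub>r)\<close> are bounded by 1, so Montel's
  theorem gives a limit \<open>exp (-G)\<close> as \<open>r\<close> tends to 1, and Jensen's inequality keeps the \<open>L\<^sup>p\<close> means
  bounded and the limit free of zeros.

  That \<open>exp G\<close> is outer needs boundary values. Since \<open>exp (-G)\<close> is bounded, Fatou's theorem
  (\<open>bounded_holomorphic_radial_limits\<close>) gives radial limits almost everywhere; they are nonzero almost
  everywhere by Fatou's lemma. As \<open>p > 1\<close>, bounded \<open>L\<^sup>p\<close> means make \<open>Re G\<close> uniformly integrable on circles,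
  so it converges in \<open>L\<^sup>1\<close> to its boundary function, and the Schwarz formula on smaller circles
  passes to the limit. Fatou's theorem itself is proved by approximating with Taylor polynomials in
  the Hardy space \<open>H\<^sup>2\<close> and controlling the error by a weak type maximal inequality.
\<close>

section \<open>Schwarz and Poisson integrals\<close>

definition schwarz_kernel :: "complex \<Rightarrow> real \<Rightarrow> complex"
  where "schwarz_kernel z t = (cis t + z) / (cis t - z)"

definition poisson_kernel :: "complex \<Rightarrow> real \<Rightarrow> real"
  where "poisson_kernel z t = Re (schwarz_kernel z t)"

definition schwarz_integral :: "(real \<Rightarrow> real) \<Rightarrow> complex \<Rightarrow> complex"
  where "schwarz_integral v z = 1 / (2 * complex_of_real pi) *
    (LINT t|circle_measure. schwarz_kernel z t * complex_of_real (v t))"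

definition poisson_integral :: "(real \<Rightarrow> real) \<Rightarrow> complex \<Rightarrow> real"
  where "poisson_integral v z = (LINT t|circle_measure. poisson_kernel z t * v t) / (2 * pi)"

lemma cis_minus_nonzero: "z \<in> unit_disc \<Longrightarrow> cis t - z \<noteq> 0"
  by (metis dist_norm mem_ball_0 norm_cis order_less_irrefl right_minus_eq)

lemma radius_cis_in_disc: "0 \<le> r \<Longrightarrow> r < 1 \<Longrightarrow> complex_of_real r * cis t \<in> unit_disc"
  by (simp add: norm_mult)

lemma dilation_in_disc:
  assumes "0 \<le> r" "r < 1" "w \<in> cball 0 1"
  shows "complex_of_real r * w \<in> unit_disc"
proof -
  have "r * cmod w \<le> r * 1" using assms by (intro mult_left_mono) auto
  then show ?thesis using assms by (simp add: norm_mult)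
qed

lemma holomorphic_dilation:
  assumes f: "f holomorphic_on unit_disc" and r: "0 \<le> r" "r < 1"
  shows "(\<lambda>w. f (complex_of_real r * w)) holomorphic_on cball 0 1"
  using dilation_in_disc[OF r]
  by (intro holomorphic_on_compose_gen[OF _ f, unfolded o_def] holomorphic_intros) auto

lemma continuous_schwarz_kernel:
  assumes "continuous_on S f" "continuous_on S g" "\<And>x. x \<in> S \<Longrightarrow> f x \<in> unit_disc"
  shows "continuous_on S (\<lambda>x. schwarz_kernel (f x) (g x))"
  unfolding schwarz_kernel_def
  using assms(3) cis_minus_nonzero by (intro continuous_intros assms(1,2)) blast

lemma continuous_poisson_kernel:
  assumes "continuous_on S f" "continuous_on S g" "\<And>x. x \<in> S \<Longrightarrow> f x \<in> unit_disc"
  shows "continuous_on S (\<lambda>x. poisson_kernel (f x) (g x))"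
  unfolding poisson_kernel_def
  by (intro continuous_intros continuous_schwarz_kernel assms)

lemma norm_schwarz_kernel_le:
  assumes "z \<in> unit_disc"
  shows "cmod (schwarz_kernel z t) \<le> 2 / (1 - cmod z)"
proof -
  have "cmod (cis t + z) \<le> 2" using norm_triangle_ineq[of "cis t" z] assms by simp
  moreover have "1 - cmod z \<le> cmod (cis t - z)" using norm_triangle_ineq2[of "cis t" z] by simp
  ultimately show ?thesis using assms by (simp add: schwarz_kernel_def norm_divide frac_le)
qed

lemma poisson_kernel_eq:
  assumes "z \<in> unit_disc"
  shows "poisson_kernel z t = (1 - (cmod z)\<^sup>2) / (cmod (cis t - z))\<^sup>2"
proof -
  have "Re ((cis t + z) * cnj (cis t - z)) = (cmod (cis t))\<^sup>2 - (cmod z)\<^sup>2"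
    by (simp only: cmod_power2) (simp add: algebra_simps power2_eq_square)
  moreover have "schwarz_kernel z t = (cis t + z) * cnj (cis t - z) / complex_of_real ((cmod (cis t - z))\<^sup>2)"
    unfolding schwarz_kernel_def by (rule complex_div_cnj)
  ultimately show ?thesis
    by (simp only: poisson_kernel_def Re_divide_of_real norm_cis power_one)
qed

lemma poisson_kernel_nonneg: "z \<in> unit_disc \<Longrightarrow> 0 \<le> poisson_kernel z t"
  by (simp add: poisson_kernel_eq abs_square_le_1)

lemma abs_poisson_kernel_le: "z \<in> unit_disc \<Longrightarrow> \<bar>poisson_kernel z t\<bar> \<le> 2 / (1 - cmod z)"
  unfolding poisson_kernel_def using norm_schwarz_kernel_le abs_Re_le_cmod order_trans by blast

lemma continuous_integrable_circle:
  fixes f :: "real \<Rightarrow> 'a::euclidean_space"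
  assumes "continuous_on {0..2*pi} f"
  shows "integrable circle_measure f"
  using continuous_imp_integrable_real[OF assms] .

lemma integrable_schwarz_kernel_mult:
  assumes z: "z \<in> unit_disc" and v: "integrable circle_measure v"
  shows "integrable circle_measure (\<lambda>t. schwarz_kernel z t * complex_of_real (v t))"
proof (rule Bochner_Integration.integrable_bound)
  show "integrable circle_measure (\<lambda>t. 2 / (1 - cmod z) * v t)" using v by simp
  have "continuous_on {0..2*pi} (schwarz_kernel z)"
    using z by (intro continuous_schwarz_kernel) auto
  then have [measurable]: "schwarz_kernel z \<in> borel_measurable circle_measure"
    by (intro continuous_imp_measurable_on_sets_lebesgue) auto
  have [measurable]: "v \<in> borel_measurable circle_measure" using v by auto
  show "(\<lambda>t. schwarz_kernel z t * complex_of_real (v t)) \<in> borel_measurable circle_measure"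
    by measurable
  have "cmod (schwarz_kernel z t) * \<bar>v t\<bar> \<le> \<bar>2 / (1 - cmod z)\<bar> * \<bar>v t\<bar>" for t
    using norm_schwarz_kernel_le[OF z, of t] z by (intro mult_right_mono) auto
  then show "AE t in circle_measure. norm (schwarz_kernel z t * complex_of_real (v t))
      \<le> norm (2 / (1 - cmod z) * v t)"
    by (simp add: norm_mult abs_mult)
qed

lemma integrable_poisson_kernel_mult:
  assumes "z \<in> unit_disc" "integrable circle_measure v"
  shows "integrable circle_measure (\<lambda>t. poisson_kernel z t * v t)"
  using integrable_Re[OF integrable_schwarz_kernel_mult[OF assms]] by (simp add: poisson_kernel_def)

lemma Re_schwarz_integral:
  assumes "z \<in> unit_disc" "integrable circle_measure v"
  shows "Re (schwarz_integral v z) = poisson_integral v z"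
proof -
  have "(LINT t|circle_measure. Re (schwarz_kernel z t * complex_of_real (v t)))
      = Re (LINT t|circle_measure. schwarz_kernel z t * complex_of_real (v t))"
    by (rule integral_Re[OF integrable_schwarz_kernel_mult[OF assms]])
  then show ?thesis
    by (simp add: schwarz_integral_def poisson_integral_def poisson_kernel_def Re_divide' power2_eq_square)
qed

lemma cauchy_formula_circle:
  assumes g: "g holomorphic_on cball 0 1" and z: "z \<in> unit_disc"
  shows "(LINT t|circle_measure. g (cis t) * (cis t / (cis t - z))) = 2 * complex_of_real pi * g z"
proof -
  have "((\<lambda>u. g u / (u - z)) has_contour_integral (2 * complex_of_real pi * \<i> * g z)) (circlepath 0 1)"
    using z by (intro Cauchy_integral_circlepath_simple[OF g]) auto
  then have "((\<lambda>t. g (0 + complex_of_real 1 * cis t) / (0 + complex_of_real 1 * cis t - z)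
      * complex_of_real 1 * \<i> * cis t) has_integral 2 * complex_of_real pi * \<i> * g z) {0..2*pi}"
    unfolding circlepath_def by (subst (asm) has_contour_integral_part_circlepath_iff) auto
  from has_integral_mult_right[OF this, of "-\<i>"]
  have hi: "((\<lambda>t. g (cis t) * (cis t / (cis t - z))) has_integral 2 * complex_of_real pi * g z) {0..2*pi}"
    by (simp add: mult_ac)
  have "continuous_on {0..2*pi} (\<lambda>t. g (cis t))"
    by (intro continuous_on_compose2[OF holomorphic_on_imp_continuous_on[OF g]] continuous_intros) auto
  then have "integrable circle_measure (\<lambda>t. g (cis t) * (cis t / (cis t - z)))"
    using cis_minus_nonzero[OF z] by (intro continuous_integrable_circle continuous_intros) auto
  then show ?thesis using hi
    by (simp add: lebesgue_integral_eq_integral integral_unique)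
qed

lemma mean_value_circle:
  assumes "g holomorphic_on cball 0 1"
  shows "(LINT t|circle_measure. g (cis t)) = 2 * complex_of_real pi * g 0"
  using cauchy_formula_circle[OF assms, of 0] by simp

text \<open>
  The kernel is \<open>2 \<zeta> / (\<zeta> - z) - 1\<close>, so against \<open>g\<close> it gives \<open>2 g z - g 0\<close>
  by Cauchy's formula. Its conjugate is, on the circle, a function holomorphic in the closed disc with
  value 1 at 0, so against the conjugate of \<open>g\<close> it gives the conjugate of \<open>g 0\<close>. Half the sum is the formula.
\<close>

lemma schwarz_formula:
  assumes g: "g holomorphic_on cball 0 1" and z: "z \<in> unit_disc"
  shows "g z = schwarz_integral (\<lambda>t. Re (g (cis t))) z + \<i> * complex_of_real (Im (g 0))"
proof -
  let ?k = "schwarz_kernel z" and ?L = "\<lambda>f. integral\<^sup>L circle_measure f"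
  have gc: "continuous_on {0..2*pi} (\<lambda>t. g (cis t))"
    by (intro continuous_on_compose2[OF holomorphic_on_imp_continuous_on[OF g]] continuous_intros) auto
  have kc: "continuous_on {0..2*pi} ?k" using z by (intro continuous_schwarz_kernel) auto
  have k1: "?k t = 2 * (cis t / (cis t - z)) - 1" for t
    using cis_minus_nonzero[OF z, of t] by (simp add: schwarz_kernel_def field_simps)
  have i1: "integrable circle_measure (\<lambda>t. g (cis t) * (cis t / (cis t - z)))"
    using cis_minus_nonzero[OF z] gc by (intro continuous_integrable_circle continuous_intros) auto
  have "?L (\<lambda>t. ?k t * g (cis t)) = ?L (\<lambda>t. 2 * (g (cis t) * (cis t / (cis t - z))) - g (cis t))"
    by (rule Bochner_Integration.integral_cong) (auto simp: k1 algebra_simps)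
  also have "\<dots> = 2 * ?L (\<lambda>t. g (cis t) * (cis t / (cis t - z))) - ?L (\<lambda>t. g (cis t))"
    using i1 continuous_integrable_circle[OF gc]
    by (simp only: Bochner_Integration.integral_diff integrable_mult_right integral_mult_right_zero)
  also have "\<dots> = 2 * pi * (2 * g z - g 0)"
    using cauchy_formula_circle[OF g z] mean_value_circle[OF g] by (simp add: algebra_simps)
  finally have a: "?L (\<lambda>t. ?k t * g (cis t)) = 2 * pi * (2 * g z - g 0)" .
  have nz: "1 - cnj z * w \<noteq> 0" if "w \<in> cball 0 1" for w
  proof
    assume "1 - cnj z * w = 0"
    then have "cmod (cnj z * w) = 1" by simp
    moreover have "cmod (cnj z * w) \<le> cmod z * 1" using that by (simp add: norm_mult mult_left_le)
    ultimately show False using z by auto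
  qed
  have hol: "(\<lambda>w. (1 + cnj z * w) / (1 - cnj z * w) * g w) holomorphic_on cball 0 1"
    using nz by (intro holomorphic_intros g) auto
  have k2: "cnj (?k t) = (1 + cnj z * cis t) / (1 - cnj z * cis t)" for t
  proof -
    have "cnj (?k t) = (cis (-t) + cnj z) / (cis (-t) - cnj z)" by (simp add: schwarz_kernel_def cis_cnj)
    also have "\<dots> = (cis t * (cis (-t) + cnj z)) / (cis t * (cis (-t) - cnj z))" by simp
    also have "\<dots> = (1 + cnj z * cis t) / (1 - cnj z * cis t)"
      by (simp add: distrib_left right_diff_distrib cis_mult mult.commute)
    finally show ?thesis .
  qed
  have "?L (\<lambda>t. ?k t * cnj (g (cis t))) = cnj (?L (\<lambda>t. cnj (?k t) * g (cis t)))"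
    by (simp flip: Bochner_Integration.integral_cnj)
  also have "?L (\<lambda>t. cnj (?k t) * g (cis t)) = 2 * pi * g 0"
    using mean_value_circle[OF hol] by (simp add: k2)
  finally have b: "?L (\<lambda>t. ?k t * cnj (g (cis t))) = 2 * pi * cnj (g 0)" by simp
  have "?L (\<lambda>t. ?k t * complex_of_real (Re (g (cis t))))
      = ?L (\<lambda>t. (?k t * g (cis t) + ?k t * cnj (g (cis t))) / 2)"
    by (rule Bochner_Integration.integral_cong) (auto simp: complex_add_cnj simp flip: distrib_left)
  also have "\<dots> = (?L (\<lambda>t. ?k t * g (cis t)) + ?L (\<lambda>t. ?k t * cnj (g (cis t)))) / 2"
    by (simp, subst Bochner_Integration.integral_add)
       (auto intro!: continuous_integrable_circle continuous_intros gc kc)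
  also have "\<dots> = 2 * pi * (g z - (g 0 - cnj (g 0)) / 2)"
    by (simp only: a b) (simp add: field_simps)
  also have "(g 0 - cnj (g 0)) / 2 = \<i> * Im (g 0)" by (simp add: complex_eq_iff)
  finally show ?thesis by (simp add: schwarz_integral_def)
qed

lemma poisson_formula:
  assumes g: "g holomorphic_on cball 0 1" and z: "z \<in> unit_disc"
  shows "Re (g z) = poisson_integral (\<lambda>t. Re (g (cis t))) z"
proof -
  have "continuous_on {0..2*pi} (\<lambda>t. Re (g (cis t)))"
    by (intro continuous_intros continuous_on_compose2[OF holomorphic_on_imp_continuous_on[OF g]]) auto
  then show ?thesis
    using Re_schwarz_integral[OF z continuous_integrable_circle] arg_cong[OF schwarz_formula[OF assms], of Re]
    by simp
qed

lemma poisson_integral_const: "z \<in> unit_disc \<Longrightarrow> poisson_integral (\<lambda>t. c) z = c"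
  using poisson_formula[of "\<lambda>_. complex_of_real c" z] by simp

lemma poisson_integral_mono:
  assumes "z \<in> unit_disc" "integrable circle_measure u" "integrable circle_measure v"
    and "\<And>t. t \<in> {0..2*pi} \<Longrightarrow> u t \<le> v t"
  shows "poisson_integral u z \<le> poisson_integral v z"
  unfolding poisson_integral_def
  using assms by (intro divide_right_mono integral_mono integrable_poisson_kernel_mult mult_left_mono
      poisson_kernel_nonneg) auto

lemma poisson_integral_add:
  assumes "z \<in> unit_disc" "integrable circle_measure u" "integrable circle_measure v"
  shows "poisson_integral (\<lambda>t. u t + v t) z = poisson_integral u z + poisson_integral v z"
  using assms by (simp add: poisson_integral_def distrib_left integrable_poisson_kernel_mult add_divide_distrib)

lemma poisson_integral_cmult: "poisson_integral (\<lambda>t. c * v t) z = c * poisson_integral v z"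
  by (simp add: poisson_integral_def mult.left_commute)

lemma poisson_integral_nonneg:
  assumes "z \<in> unit_disc" "\<And>t. 0 \<le> v t"
  shows "0 \<le> poisson_integral v z"
  unfolding poisson_integral_def
  using assms by (intro divide_nonneg_pos integral_nonneg_AE AE_I2 mult_nonneg_nonneg poisson_kernel_nonneg) auto

lemma holomorphic_schwarz_integral:
  assumes "continuous_on {0..2*pi} v"
  shows "schwarz_integral v holomorphic_on unit_disc"
proof -
  let ?f = "\<lambda>z t. schwarz_kernel z t * complex_of_real (v t)"
  let ?f' = "\<lambda>z t. 2 * cis t / (cis t - z)\<^sup>2 * complex_of_real (v t)"
  have c1: "continuous_on {0..2*pi} (?f z)" if "z \<in> unit_disc" for z
    using that assms by (intro continuous_intros continuous_schwarz_kernel) auto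
  have "(\<lambda>z. integral (cbox 0 (2*pi)) (?f z)) holomorphic_on unit_disc"
  proof (rule leibniz_rule_holomorphic)
    fix z t assume z: "z \<in> unit_disc"
    show "((\<lambda>z. ?f z t) has_field_derivative ?f' z t) (at z within unit_disc)"
      unfolding schwarz_kernel_def using cis_minus_nonzero[OF z, of t]
      by (auto intro!: derivative_eq_intros simp: field_simps power2_eq_square)
  next
    fix z assume "z \<in> unit_disc"
    then show "?f z integrable_on cbox 0 (2*pi)"
      using c1 by (intro integrable_continuous) auto
  next
    have "continuous_on (unit_disc \<times> cbox 0 (2*pi)) (\<lambda>x. 2 * cis (snd x) / (cis (snd x) - fst x)\<^sup>2 * complex_of_real (v (snd x)))"
      using assms cis_minus_nonzero
      by (intro continuous_intros continuous_on_compose2[OF assms]) (auto simp del: mem_ball)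
    then show "continuous_on (unit_disc \<times> cbox 0 (2*pi)) (\<lambda>(z, t). ?f' z t)"
      by (simp add: case_prod_unfold)
  qed auto
  then have "(\<lambda>z. 1 / (2 * complex_of_real pi) * integral (cbox 0 (2*pi)) (?f z)) holomorphic_on unit_disc"
    by (intro holomorphic_intros) auto
  moreover have "1 / (2 * complex_of_real pi) * integral (cbox 0 (2*pi)) (?f z) = schwarz_integral v z"
    if "z \<in> unit_disc" for z
    unfolding schwarz_integral_def
    using lebesgue_integral_eq_integral[OF continuous_integrable_circle[OF c1[OF that]]] by simp
  ultimately show ?thesis by (rule holomorphic_transform)
qed

section \<open>Lebesgue means of Poisson integrals\<close>

lemma powr_above_tangent:
  fixes a x p :: real
  assumes "0 < a" "0 \<le> x" "1 < p"
  shows "a powr p + p * a powr (p - 1) * (x - a) \<le> x powr p"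
proof (cases "x = 0")
  case True
  have "a powr (p - 1) * a = a powr p"
    using assms powr_add[of a "p - 1" 1] by simp
  with assms True show ?thesis by (simp add: mult.assoc)
next
  case False
  have "p * a powr (p - 1) * (x - a) \<le> x powr p - a powr p"
  proof (rule convex_on_imp_above_tangent)
    show "convex_on {0<..} (\<lambda>x. x powr p)" using assms by (intro powr_convex) auto
    show "((\<lambda>x. x powr p) has_field_derivative p * a powr (p - 1)) (at a within {0<..})"
      using assms by (auto intro!: derivative_eq_intros simp: powr_diff)
  qed (use assms False in \<open>auto simp: interior_open\<close>)
  then show ?thesis by simp
qed

text \<open>
  Jensen's inequality for the probability density \<open>poisson_kernel z t / (2 \<pi>)\<close>: integrate the
  tangent line inequality of \<open>x powr p\<close> at the mean value.
\<close>

lemma poisson_integral_powr_le: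
  assumes z: "z \<in> unit_disc" and p: "1 < p" and v: "\<And>t. 0 \<le> v t"
    and iv: "integrable circle_measure v" and ip: "integrable circle_measure (\<lambda>t. v t powr p)"
  shows "poisson_integral v z powr p \<le> poisson_integral (\<lambda>t. v t powr p) z"
proof (cases "poisson_integral v z = 0")
  case True
  then show ?thesis using z p by (simp add: poisson_integral_nonneg)
next
  case False
  define a where "a = poisson_integral v z"
  have a: "0 < a" using False poisson_integral_nonneg[OF z, of v] v by (simp add: a_def)
  define c where "c = p * a powr (p - 1)"
  have "a powr p = (a powr p - c * a) + c * poisson_integral v z"
    by (simp add: a_def)
  also have "\<dots> = poisson_integral (\<lambda>t. (a powr p - c * a) + c * v t) z"
    using z iv by (simp add: poisson_integral_add poisson_integral_const poisson_integral_cmult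
        continuous_integrable_circle)
  also have "\<dots> \<le> poisson_integral (\<lambda>t. v t powr p) z"
  proof (rule poisson_integral_mono[OF z _ ip])
    show "integrable circle_measure (\<lambda>t. a powr p - c * a + c * v t)"
      using iv by (simp add: continuous_integrable_circle)
    show "a powr p - c * a + c * v t \<le> v t powr p" for t
      using powr_above_tangent[OF a v p, of t] by (simp add: c_def algebra_simps)
  qed
  finally show ?thesis by (simp add: a_def)
qed

lemma finite_measure_circle: "finite_measure circle_measure"
  by (rule finite_measure_lebesgue_on) auto

text \<open>
  The kernel is symmetric in its two angles, so it also averages to 1 over circles of the disc.
  Here this is the mean value property of \<open>(\<zeta> + r z) / (\<zeta> - r z)\<close> as a function of \<open>z\<close>.
\<close>

lemma poisson_kernel_mean:
  assumes "0 \<le> r" "r < 1"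
  shows "(LINT \<theta>|circle_measure. poisson_kernel (complex_of_real r * cis \<theta>) t) = 2 * pi"
proof -
  let ?g = "\<lambda>z. (cis t + complex_of_real r * z) / (cis t - complex_of_real r * z)"
  note rz = dilation_in_disc[OF assms]
  have "?g holomorphic_on cball 0 1"
    using cis_minus_nonzero[OF rz] by (intro holomorphic_intros) auto
  from mean_value_circle[OF this]
  have "(LINT \<theta>|circle_measure. schwarz_kernel (complex_of_real r * cis \<theta>) t) = 2 * complex_of_real pi"
    by (simp add: schwarz_kernel_def)
  moreover have "continuous_on {0..2*pi} (\<lambda>\<theta>. schwarz_kernel (complex_of_real r * cis \<theta>) t)"
    using assms by (intro continuous_schwarz_kernel continuous_intros radius_cis_in_disc)
  ultimately show ?thesis
    using integral_Re[OF continuous_integrable_circle] by (simp add: poisson_kernel_def)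
qed

lemma nn_integral_poisson:
  assumes z: "z \<in> unit_disc" and iv: "integrable circle_measure v" and v: "\<And>t. 0 \<le> v t"
  shows "ennreal (poisson_integral v z) = (\<integral>\<^sup>+t. ennreal (poisson_kernel z t * v t / (2 * pi)) \<partial>circle_measure)"
proof -
  have "integrable circle_measure (\<lambda>t. poisson_kernel z t * v t / (2 * pi))"
    using integrable_poisson_kernel_mult[OF z iv] by simp
  from nn_integral_eq_integral[OF this] show ?thesis
    using poisson_kernel_nonneg[OF z] v by (simp add: poisson_integral_def)
qed

text \<open>
  Averaging Jensen's inequality over the circle and exchanging the integrals.
\<close>

lemma poisson_integral_Lp:
  assumes r: "0 \<le> r" "r < 1" and p: "1 < p" and v: "\<And>t. 0 \<le> v t"
    and iv: "integrable circle_measure v" and ip: "integrable circle_measure (\<lambda>t. v t powr p)"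
  shows "(\<integral>\<^sup>+\<theta>. ennreal (poisson_integral v (complex_of_real r * cis \<theta>) powr p) \<partial>circle_measure)
    \<le> (\<integral>\<^sup>+t. ennreal (v t powr p) \<partial>circle_measure)"
proof -
  interpret finite_measure circle_measure by (rule finite_measure_circle)
  interpret pair_sigma_finite circle_measure circle_measure ..
  let ?z = "\<lambda>\<theta>. complex_of_real r * cis \<theta>"
  note z = radius_cis_in_disc[OF r]
  have [measurable]: "v \<in> borel_measurable circle_measure" using iv by auto
  have c: "continuous_on UNIV (\<lambda>x. poisson_kernel (?z (fst x)) (snd x))"
    using z by (intro continuous_poisson_kernel continuous_intros) auto
  have idm: "(\<lambda>x. x) \<in> borel_measurable circle_measure"
    by (intro continuous_imp_measurable_on_sets_lebesgue continuous_on_id) auto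
  have fs: "(\<lambda>x. fst x) \<in> borel_measurable (circle_measure \<Otimes>\<^sub>M circle_measure)"
    "(\<lambda>x. snd x) \<in> borel_measurable (circle_measure \<Otimes>\<^sub>M circle_measure)"
    using measurable_compose[OF measurable_fst idm] measurable_compose[OF measurable_snd idm] by auto
  have [measurable]: "(\<lambda>x. poisson_kernel (?z (fst x)) (snd x)) \<in> borel_measurable (circle_measure \<Otimes>\<^sub>M circle_measure)"
    using measurable_compose[OF borel_measurable_Pair[OF fs] borel_measurable_continuous_onI[OF c]] by simp
  have "(\<integral>\<^sup>+\<theta>. ennreal (poisson_integral v (?z \<theta>) powr p) \<partial>circle_measure)
      \<le> (\<integral>\<^sup>+\<theta>. ennreal (poisson_integral (\<lambda>t. v t powr p) (?z \<theta>)) \<partial>circle_measure)"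
    by (intro nn_integral_mono ennreal_leI poisson_integral_powr_le z p v iv ip)
  also have "\<dots> = (\<integral>\<^sup>+\<theta>. \<integral>\<^sup>+t. ennreal (poisson_kernel (?z \<theta>) t * v t powr p / (2 * pi)) \<partial>circle_measure \<partial>circle_measure)"
    by (intro nn_integral_cong nn_integral_poisson z ip) auto
  also have "\<dots> = (\<integral>\<^sup>+t. \<integral>\<^sup>+\<theta>. ennreal (poisson_kernel (?z \<theta>) t * v t powr p / (2 * pi)) \<partial>circle_measure \<partial>circle_measure)"
    by (rule Fubini'[symmetric]) (simp add: case_prod_unfold)
  also have "\<dots> = (\<integral>\<^sup>+t. ennreal (v t powr p) \<partial>circle_measure)"
  proof (rule nn_integral_cong)
    fix t
    have "continuous_on {0..2*pi} (\<lambda>\<theta>. poisson_kernel (?z \<theta>) t)"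
      using z by (intro continuous_poisson_kernel continuous_intros)
    then have "integrable circle_measure (\<lambda>\<theta>. poisson_kernel (?z \<theta>) t * v t powr p / (2 * pi))"
      by (intro continuous_integrable_circle continuous_intros) auto
    from nn_integral_eq_integral[OF this]
    show "(\<integral>\<^sup>+\<theta>. ennreal (poisson_kernel (?z \<theta>) t * v t powr p / (2 * pi)) \<partial>circle_measure) = ennreal (v t powr p)"
      using poisson_kernel_nonneg[OF z] poisson_kernel_mean[OF r, of t] by simp
  qed
  finally show ?thesis .
qed

lemma in_L1_imp_integrable: "in_Lp 1 M u \<Longrightarrow> integrable M u"
  by (auto simp: in_Lp_def integrable_abs_iff)

text \<open>
  \<open>log\<^sup>+\<close> of the modulus of \<open>F\<close> is at most the Poisson integral of the absolute value of its logarithmic boundary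
  modulus, whose \<open>L\<^sup>p\<close> means are bounded.
\<close>

lemma outer_function_in_N_ring:
  assumes p: "1 < p" and F: "outer_function F"
    and Lp: "in_Lp p circle_measure (\<lambda>t. ln (cmod (radial_boundary F t)))"
  shows "(\<lambda>z\<in>unit_disc. F z) \<in> carrier (N_ring p)"
proof -
  define v where "v = (\<lambda>t. ln (cmod (radial_boundary F t)))"
  have iv: "integrable circle_measure v"
    using F by (auto simp: outer_function_def v_def intro: in_L1_imp_integrable)
  have ip: "integrable circle_measure (\<lambda>t. \<bar>v t\<bar> powr p)"
    using Lp by (simp add: in_Lp_def v_def)
  obtain c where c: "cmod c = 1" "\<And>z. z \<in> unit_disc \<Longrightarrow> F z = c * exp (schwarz_integral v z)"
    using F unfolding outer_function_def schwarz_integral_def schwarz_kernel_def v_def by blast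
  have hol: "F holomorphic_on unit_disc" using F by (simp add: outer_function_def)
  have le: "log_plus (cmod (F z)) \<le> poisson_integral (\<lambda>t. \<bar>v t\<bar>) z" if z: "z \<in> unit_disc" for z
  proof -
    have "ln (cmod (F z)) = poisson_integral v z"
      using c z Re_schwarz_integral[OF z iv] by (simp add: norm_mult)
    also have "\<dots> \<le> poisson_integral (\<lambda>t. \<bar>v t\<bar>) z"
      using iv by (intro poisson_integral_mono z) auto
    finally show ?thesis
      using poisson_integral_nonneg[OF z, of "\<lambda>t. \<bar>v t\<bar>"] by (simp add: log_plus_def)
  qed
  have "(SUP r\<in>{0<..<1}. \<integral>\<^sup>+ t. ennreal (log_plus (cmod ((\<lambda>z\<in>unit_disc. F z) (complex_of_real r * cis t))) powr p / (2*pi))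
       \<partial>circle_measure) \<le> (\<integral>\<^sup>+t. ennreal (\<bar>v t\<bar> powr p) \<partial>circle_measure)"
  proof (rule SUP_least)
    fix r :: real assume r: "r \<in> {0<..<1}"
    then have z: "complex_of_real r * cis t \<in> unit_disc" for t by (intro radius_cis_in_disc) auto
    have "log_plus (cmod (F (complex_of_real r * cis t))) powr p / (2*pi)
        \<le> poisson_integral (\<lambda>t. \<bar>v t\<bar>) (complex_of_real r * cis t) powr p" for t
    proof -
      have "log_plus (cmod (F (complex_of_real r * cis t))) powr p / (2*pi)
          \<le> log_plus (cmod (F (complex_of_real r * cis t))) powr p / 1"
        using pi_gt3 by (intro divide_left_mono) auto
      also have "\<dots> \<le> poisson_integral (\<lambda>t. \<bar>v t\<bar>) (complex_of_real r * cis t) powr p"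
        using p le[OF z, of t] log_plus_nonneg by (simp add: powr_mono2)
      finally show ?thesis .
    qed
    then have "(\<integral>\<^sup>+ t. ennreal (log_plus (cmod ((\<lambda>z\<in>unit_disc. F z) (complex_of_real r * cis t))) powr p / (2*pi)) \<partial>circle_measure)
        \<le> (\<integral>\<^sup>+ t. ennreal (poisson_integral (\<lambda>t. \<bar>v t\<bar>) (complex_of_real r * cis t) powr p) \<partial>circle_measure)"
      using z by (intro nn_integral_mono ennreal_leI) (simp del: mem_ball mem_ball_0)
    also have "\<dots> \<le> (\<integral>\<^sup>+t. ennreal (\<bar>v t\<bar> powr p) \<partial>circle_measure)"
      using r iv ip p by (intro poisson_integral_Lp) auto
    finally show "(\<integral>\<^sup>+ t. ennreal (log_plus (cmod ((\<lambda>z\<in>unit_disc. F z) (complex_of_real r * cis t))) powr p / (2*pi)) \<partial>circle_measure)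
        \<le> (\<integral>\<^sup>+t. ennreal (\<bar>v t\<bar> powr p) \<partial>circle_measure)" .
  qed
  also have "\<dots> < \<infinity>" using ip by (simp add: integrable_iff_bounded)
  finally have "(SUP r\<in>{0<..<1}. \<integral>\<^sup>+ t. ennreal (log_plus (cmod ((\<lambda>z\<in>unit_disc. F z) (complex_of_real r * cis t))) powr p / (2*pi))
       \<partial>circle_measure) < \<infinity>" .
  moreover have "(\<lambda>z\<in>unit_disc. F z) holomorphic_on unit_disc"
    using hol by (rule holomorphic_transform) simp
  ultimately show ?thesis by (simp add: N_ring_def disc_fun_ring_def)
qed

section \<open>Poisson majorants\<close>

text \<open>
  A quadratic bound is what the Poisson integral can evaluate exactly: on the circle,
  \<open>\<bar>w - \<zeta>\<bar>\<^sup>2 = 2 - 2 Re (w cnj \<zeta>)\<close> is the real part of a polynomial in \<open>w\<close>.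
\<close>

lemma quadratic_modulus_of_continuity:
  fixes \<phi> :: "complex \<Rightarrow> real"
  assumes c: "continuous_on (sphere 0 1) \<phi>" and e: "0 < e"
  obtains K where "0 \<le> K"
    "\<And>w \<zeta>. w \<in> sphere 0 1 \<Longrightarrow> \<zeta> \<in> sphere 0 1 \<Longrightarrow> \<phi> \<zeta> - \<phi> w \<le> e + K * (cmod (w - \<zeta>))\<^sup>2"
proof -
  have "uniformly_continuous_on (sphere 0 1) \<phi>"
    by (intro compact_uniformly_continuous c) auto
  then obtain d where d: "0 < d"
    "\<And>w \<zeta>. w \<in> sphere 0 1 \<Longrightarrow> \<zeta> \<in> sphere 0 1 \<Longrightarrow> dist \<zeta> w < d \<Longrightarrow> dist (\<phi> \<zeta>) (\<phi> w) < e"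
    using e unfolding uniformly_continuous_on_def by metis
  have "bounded (\<phi> ` sphere 0 1)"
    by (intro compact_imp_bounded compact_continuous_image c) auto
  then obtain M where M: "\<And>w. w \<in> sphere 0 1 \<Longrightarrow> \<bar>\<phi> w\<bar> \<le> M"
    unfolding bounded_iff real_norm_def ball_simps by blast
  have M0: "0 \<le> M" using M[of 1] by simp
  show thesis
  proof (rule that[of "2 * M / d\<^sup>2"])
    show "0 \<le> 2 * M / d\<^sup>2" using M0 by simp
    fix w \<zeta> :: complex assume s: "w \<in> sphere 0 1" "\<zeta> \<in> sphere 0 1"
    show "\<phi> \<zeta> - \<phi> w \<le> e + 2 * M / d\<^sup>2 * (cmod (w - \<zeta>))\<^sup>2"
    proof (cases "dist \<zeta> w < d")
      case True
      have "\<phi> \<zeta> - \<phi> w \<le> e" using d(2)[OF s True] by (simp add: dist_real_def)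
      moreover have "0 \<le> 2 * M / d\<^sup>2 * (cmod (w - \<zeta>))\<^sup>2" using M0 by simp
      ultimately show ?thesis by linarith
    next
      case False
      then have "d\<^sup>2 \<le> (cmod (w - \<zeta>))\<^sup>2"
        using d(1) by (intro power_mono) (auto simp: dist_norm norm_minus_commute)
      then have "2 * M / d\<^sup>2 * d\<^sup>2 \<le> 2 * M / d\<^sup>2 * (cmod (w - \<zeta>))\<^sup>2"
        using M0 by (intro mult_left_mono) auto
      then have "2 * M \<le> 2 * M / d\<^sup>2 * (cmod (w - \<zeta>))\<^sup>2" using d(1) by simp
      moreover have "\<phi> \<zeta> - \<phi> w \<le> 2 * M" using M[OF s(1)] M[OF s(2)] by linarith
      ultimately show ?thesis using e by linarith
    qed
  qed
qed

lemma continuous_circle_trace: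
  assumes "continuous_on (sphere 0 1) \<phi>"
  shows "continuous_on S (\<lambda>t. \<phi> (cis t))"
  by (intro continuous_on_compose2[OF assms] continuous_intros) auto

text \<open>
  Korovkin's argument for the boundary continuity of the Poisson integral, uniformly on the circle.
  The maximum principle below uses the estimate from this side.
\<close>

lemma poisson_integral_boundary_lower:
  fixes \<phi> :: "complex \<Rightarrow> real"
  assumes c: "continuous_on (sphere 0 1) \<phi>" and e: "0 < e"
  obtains K where "\<And>\<rho> \<zeta>. 0 \<le> \<rho> \<Longrightarrow> \<rho> < 1 \<Longrightarrow> \<zeta> \<in> sphere 0 1 \<Longrightarrow>
    \<phi> \<zeta> \<le> poisson_integral (\<lambda>t. \<phi> (cis t)) (complex_of_real \<rho> * \<zeta>) + e + K * (1 - \<rho>)"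
proof -
  obtain K where K: "0 \<le> K"
    "\<And>w \<zeta>. w \<in> sphere 0 1 \<Longrightarrow> \<zeta> \<in> sphere 0 1 \<Longrightarrow> \<phi> \<zeta> - \<phi> w \<le> e + K * (cmod (w - \<zeta>))\<^sup>2"
    using quadratic_modulus_of_continuity[OF c e] by blast
  show thesis
  proof (rule that[of "2 * K"])
    fix \<rho> :: real and \<zeta> :: complex
    assume \<rho>: "0 \<le> \<rho>" "\<rho> < 1" and \<zeta>: "\<zeta> \<in> sphere 0 1"
    let ?z = "complex_of_real \<rho> * \<zeta>" and ?g = "\<lambda>w. complex_of_real e + complex_of_real K * (2 - 2 * w * cnj \<zeta>)"
    have z: "?z \<in> unit_disc" using \<rho> \<zeta> by (simp add: norm_mult)
    have zz: "\<zeta> * cnj \<zeta> = 1" using \<zeta> by (simp add: complex_norm_square[symmetric])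
    have ic: "integrable circle_measure (\<lambda>t. \<phi> (cis t))"
      by (intro continuous_integrable_circle continuous_circle_trace c)
    have sq: "(cmod (cis t - \<zeta>))\<^sup>2 = Re (2 - 2 * cis t * cnj \<zeta>)" for t
    proof -
      have "(cmod (cis t - \<zeta>))\<^sup>2 = (cmod (cis t))\<^sup>2 + (cmod \<zeta>)\<^sup>2 - 2 * Re (cis t * cnj \<zeta>)"
        by (simp only: cmod_power2) (simp add: power2_eq_square algebra_simps)
      then show ?thesis using \<zeta> by simp
    qed
    have gh: "?g holomorphic_on cball 0 1" by (intro holomorphic_intros)
    have ig: "integrable circle_measure (\<lambda>t. Re (?g (cis t)))"
      by (intro continuous_integrable_circle continuous_intros)
    have "\<phi> \<zeta> = poisson_integral (\<lambda>t. \<phi> \<zeta>) ?z" using poisson_integral_const[OF z] by simp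
    also have "\<dots> \<le> poisson_integral (\<lambda>t. \<phi> (cis t) + Re (?g (cis t))) ?z"
    proof (rule poisson_integral_mono[OF z])
      show "integrable circle_measure (\<lambda>t. \<phi> \<zeta>)" by (intro continuous_integrable_circle) auto
      show "integrable circle_measure (\<lambda>t. \<phi> (cis t) + Re (?g (cis t)))" using ic ig by simp
      show "\<phi> \<zeta> \<le> \<phi> (cis t) + Re (?g (cis t))" for t
        using K(2)[of "cis t" \<zeta>] \<zeta> by (simp add: sq)
    qed
    also have "\<dots> = poisson_integral (\<lambda>t. \<phi> (cis t)) ?z + Re (?g ?z)"
      using poisson_integral_add[OF z ic ig] poisson_formula[OF gh z] by simp
    also have "?g ?z = complex_of_real e + complex_of_real K * (2 - 2 * complex_of_real \<rho> * (\<zeta> * cnj \<zeta>))"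
      by (simp add: algebra_simps)
    also have "Re \<dots> = e + 2 * K * (1 - \<rho>)" by (simp only: zz) (simp add: algebra_simps)
    finally show "\<phi> \<zeta> \<le> poisson_integral (\<lambda>t. \<phi> (cis t)) ?z + e + 2 * K * (1 - \<rho>)" by simp
  qed
qed

text \<open>
  The subharmonicity of \<open>log \<bar>h\<bar>\<close>. With \<open>S\<close> the Schwarz integral of \<open>\<phi>\<close>, the function
  \<open>h w \<cdot> exp (- S (\<rho> w))\<close> is continuous on the closed disc, and on the circle it is almost bounded by 1
  when \<open>\<rho>\<close> is close to 1. The maximum modulus principle carries the bound inside; then \<open>\<rho>\<close> tends to 1.
  The dilation by \<open>\<rho>\<close> avoids boundary values of \<open>S\<close>, whose imaginary part may have none.
\<close>

lemma poisson_majorant: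
  fixes \<phi> :: "complex \<Rightarrow> real"
  assumes h: "h holomorphic_on ball 0 1" "continuous_on (cball 0 1) h"
    and c: "continuous_on (sphere 0 1) \<phi>"
    and le: "\<And>\<zeta>. \<zeta> \<in> sphere 0 1 \<Longrightarrow> cmod (h \<zeta>) \<le> exp (\<phi> \<zeta>)"
    and z: "z \<in> unit_disc"
  shows "cmod (h z) \<le> exp (poisson_integral (\<lambda>t. \<phi> (cis t)) z)"
proof -
  let ?v = "\<lambda>t. \<phi> (cis t)"
  define S where "S = schwarz_integral ?v"
  have iv: "integrable circle_measure ?v"
    by (intro continuous_integrable_circle continuous_circle_trace c)
  have S: "S holomorphic_on unit_disc"
    unfolding S_def by (intro holomorphic_schwarz_integral continuous_circle_trace c)
  have ReS: "Re (S w) = poisson_integral ?v w" if "w \<in> unit_disc" for w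
    using Re_schwarz_integral[OF that iv] by (simp add: S_def)
  have main: "cmod (h z) \<le> exp (Re (S (complex_of_real \<rho> * z)) + (e + K * (1 - \<rho>)))"
    if \<rho>: "0 \<le> \<rho>" "\<rho> < 1" and K: "\<And>\<rho> \<zeta>. 0 \<le> \<rho> \<Longrightarrow> \<rho> < 1 \<Longrightarrow> \<zeta> \<in> sphere 0 1 \<Longrightarrow>
      \<phi> \<zeta> \<le> poisson_integral ?v (complex_of_real \<rho> * \<zeta>) + e + K * (1 - \<rho>)" for \<rho> e K
  proof -
    let ?H = "\<lambda>w. h w * exp (- S (complex_of_real \<rho> * w))"
    note in_disc = dilation_in_disc[OF \<rho>]
    have Sr: "(\<lambda>w. S (complex_of_real \<rho> * w)) holomorphic_on cball 0 1"
      by (rule holomorphic_dilation[OF S \<rho>])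
    have "cmod (?H z) \<le> exp (e + K * (1 - \<rho>))"
    proof (rule maximum_modulus_frontier[of ?H "ball 0 1"])
      show "?H holomorphic_on interior (ball 0 1)"
        using h(1) by (auto intro!: holomorphic_intros holomorphic_on_subset[OF Sr])
      show "continuous_on (closure (ball 0 1)) ?H"
        using h(2) by (auto intro!: continuous_intros holomorphic_on_imp_continuous_on[OF Sr])
      fix \<zeta> :: complex assume "\<zeta> \<in> frontier (ball 0 1)"
      then have \<zeta>: "\<zeta> \<in> sphere 0 1" by (simp add: frontier_def)
      have "cmod (?H \<zeta>) = cmod (h \<zeta>) * exp (- poisson_integral ?v (complex_of_real \<rho> * \<zeta>))"
        using in_disc[of \<zeta>] \<zeta> by (simp add: norm_mult ReS)
      also have "\<dots> \<le> exp (\<phi> \<zeta>) * exp (- poisson_integral ?v (complex_of_real \<rho> * \<zeta>))"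
        using le[OF \<zeta>] by (intro mult_right_mono) auto
      also have "\<dots> \<le> exp (e + K * (1 - \<rho>))"
        using K[OF \<rho> \<zeta>] by (simp flip: exp_add)
      finally show "cmod (?H \<zeta>) \<le> exp (e + K * (1 - \<rho>))" .
    qed (use z in auto)
    then have "cmod (h z) * exp (- Re (S (complex_of_real \<rho> * z))) * exp (Re (S (complex_of_real \<rho> * z)))
        \<le> exp (e + K * (1 - \<rho>)) * exp (Re (S (complex_of_real \<rho> * z)))"
      by (intro mult_right_mono) (auto simp: norm_mult)
    then show ?thesis by (simp add: exp_add[symmetric] exp_minus mult_ac add_ac)
  qed
  have "cmod (h z) \<le> exp (Re (S z) + e)" if e: "0 < e" for e
  proof -
    obtain K where K: "\<And>\<rho> \<zeta>. 0 \<le> \<rho> \<Longrightarrow> \<rho> < 1 \<Longrightarrow> \<zeta> \<in> sphere 0 1 \<Longrightarrow>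
      \<phi> \<zeta> \<le> poisson_integral ?v (complex_of_real \<rho> * \<zeta>) + e + K * (1 - \<rho>)"
      using poisson_integral_boundary_lower[OF c e] by blast
    have "isCont S z" using S z holomorphic_on_imp_continuous_on continuous_on_interior[of unit_disc S z]
      by (simp add: interior_open)
    then have "isCont S (complex_of_real 1 * z)" by simp
    then have "((\<lambda>\<rho>. S (complex_of_real \<rho> * z)) \<longlongrightarrow> S (complex_of_real 1 * z)) (at_left 1)"
      by (rule isCont_tendsto_compose) (intro tendsto_intros)
    then have "((\<lambda>\<rho>. exp (Re (S (complex_of_real \<rho> * z)) + (e + K * (1 - \<rho>)))) \<longlongrightarrow> exp (Re (S z) + (e + K * (1 - 1)))) (at_left 1)"
      by (intro tendsto_intros) simp
    moreover have "eventually (\<lambda>\<rho>::real. \<rho> \<in> {0<..<1}) (at_left 1)"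
      by (rule eventually_at_leftI[of 0]) auto
    then have "eventually (\<lambda>\<rho>. cmod (h z) \<le> exp (Re (S (complex_of_real \<rho> * z)) + (e + K * (1 - \<rho>)))) (at_left 1)"
      by eventually_elim (use main K in auto)
    ultimately have "cmod (h z) \<le> exp (Re (S z) + (e + K * (1 - 1)))"
      by (rule tendsto_lowerbound) simp
    then show ?thesis by simp
  qed
  then have "eventually (\<lambda>e. cmod (h z) \<le> exp (Re (S z) + e)) (at_right 0)"
    by (auto simp: eventually_at_filter)
  moreover have "((\<lambda>e. exp (Re (S z) + e)) \<longlongrightarrow> exp (Re (S z) + 0)) (at_right 0)"
    by (intro tendsto_intros)
  ultimately have "cmod (h z) \<le> exp (Re (S z) + 0)"
    by (intro tendsto_lowerbound[of _ _ "at_right (0::real)"]) auto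
  then show ?thesis using ReS[OF z] by simp
qed

text \<open>
  This form shows the continuity of \<open>log\<^sup>+\<close> at 0.
\<close>

lemma log_plus_eq_ln_max: "0 \<le> x \<Longrightarrow> log_plus x = ln (max x 1)"
  by (cases "x = 0") (auto simp: log_plus_def max_def)

lemma continuous_log_plus_cmod:
  assumes "continuous_on S f"
  shows "continuous_on S (\<lambda>x. log_plus (cmod (f x)))"
  using assms by (auto simp: log_plus_eq_ln_max intro!: continuous_intros)

lemma le_exp_log_plus: "0 \<le> x \<Longrightarrow> x \<le> exp (log_plus x)"
  by (simp add: log_plus_eq_ln_max)

section \<open>The radial maximal inequality\<close>

lemma nn_integral_interval_eq_integral:
  fixes \<phi> :: "real \<Rightarrow> real"
  assumes c: "continuous_on UNIV \<phi>" and nn: "\<And>t. 0 \<le> \<phi> t"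
  shows "(\<integral>\<^sup>+t\<in>{a..b}. ennreal (\<phi> t) \<partial>lborel) = ennreal (integral {a..b} \<phi>)"
proof (rule nn_integral_has_integral_lebesgue'[OF nn])
  show "(\<phi> has_integral integral {a..b} \<phi>) {a..b}"
    by (intro integrable_integral integrable_continuous_real continuous_on_subset[OF c]) auto
qed

text \<open>
  The weak type estimate of Hardy and Littlewood. Vitali's covering lemma selects disjoint
  intervals on which the mean of \<open>\<phi>\<close> exceeds \<open>A\<close> and whose fivefold enlargements cover \<open>E\<close>.
\<close>

lemma covering_weak_type:
  fixes \<phi> :: "real \<Rightarrow> real"
  assumes c: "continuous_on UNIV \<phi>" and nn: "\<And>t. 0 \<le> \<phi> t" and A: "0 < A"
    and E: "E \<in> sets borel"
    and big: "\<And>t. t \<in> E \<Longrightarrow> \<exists>k. 0 < k \<and> k \<le> B \<and> {t-k..t+k} \<subseteq> U \<and> 2 * k * A < integral {t-k..t+k} \<phi>"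
    and U: "U \<in> sets borel"
  shows "ennreal A * emeasure lborel E \<le> 5 * (\<integral>\<^sup>+t\<in>U. ennreal (\<phi> t) \<partial>lborel)"
proof -
  have [measurable]: "\<phi> \<in> borel_measurable borel" by (rule borel_measurable_continuous_onI[OF c])
  obtain k where k: "\<And>t. t \<in> E \<Longrightarrow> 0 < k t \<and> k t \<le> B \<and> {t - k t..t + k t} \<subseteq> U
      \<and> 2 * k t * A < integral {t - k t..t + k t} \<phi>"
    using big by metis
  let ?I = "\<lambda>t. {t - k t..t + k t}"
  have "E \<subseteq> (\<Union>t\<in>E. cball t (k t))" using k by (force simp: less_imp_le)
  then obtain C where C: "countable C" "C \<subseteq> E"
    "pairwise (\<lambda>i j. disjnt (cball i (k i)) (cball j (k j))) C" "E \<subseteq> (\<Union>i\<in>C. cball i (5 * k i))"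
    by (rule Vitali_covering_lemma_cballs[of E "\<lambda>t. t" k E B]) (use k in auto)
  define \<nu> where "\<nu> = density lborel (\<lambda>t. ennreal (\<phi> t))"
  have \<nu>: "emeasure \<nu> X = (\<integral>\<^sup>+t\<in>X. ennreal (\<phi> t) \<partial>lborel)" if "X \<in> sets borel" for X
    using that by (simp add: \<nu>_def emeasure_density)
  have "emeasure lborel E = (\<integral>\<^sup>+t. indicator E t \<partial>lborel)" using E by simp
  also have "\<dots> \<le> (\<integral>\<^sup>+t. \<integral>\<^sup>+i. indicator (cball i (5 * k i)) t \<partial>count_space C \<partial>lborel)"
  proof (rule nn_integral_mono)
    fix t
    show "indicator E t \<le> (\<integral>\<^sup>+i. indicator (cball i (5 * k i)) t \<partial>count_space C)"
    proof (cases "t \<in> E")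
      case True
      then obtain i where i: "i \<in> C" "t \<in> cball i (5 * k i)" using C(4) by blast
      have "(\<integral>\<^sup>+j. indicator {i} j \<partial>count_space C) \<le> (\<integral>\<^sup>+j. indicator (cball j (5 * k j)) t \<partial>count_space C)"
        using i by (intro nn_integral_mono) (auto simp: indicator_def)
      moreover have "(\<integral>\<^sup>+j. indicator {i} j \<partial>count_space C) = (1 :: ennreal)" using i by simp
      ultimately show ?thesis using True by simp
    qed simp
  qed
  also have "\<dots> = (\<integral>\<^sup>+i. \<integral>\<^sup>+t. indicator (cball i (5 * k i)) t \<partial>lborel \<partial>count_space C)"
    by (rule nn_integral_count_space_nn_integral[OF C(1)]) (intro borel_measurable_indicator, simp)
  also have "\<dots> = (\<integral>\<^sup>+i. ennreal (5 * (2 * k i)) \<partial>count_space C)"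
    using k C(2) by (intro nn_integral_cong) (auto simp: cball_eq_atLeastAtMost less_imp_le subset_iff)
  finally have 1: "emeasure lborel E \<le> (\<integral>\<^sup>+i. ennreal (5 * (2 * k i)) \<partial>count_space C)" .
  have "ennreal A * emeasure lborel E \<le> ennreal A * (\<integral>\<^sup>+i. ennreal (5 * (2 * k i)) \<partial>count_space C)"
    by (intro mult_left_mono 1) auto
  also have "\<dots> = (\<integral>\<^sup>+i. ennreal A * ennreal (5 * (2 * k i)) \<partial>count_space C)"
    by (simp add: nn_integral_cmult)
  also have "\<dots> \<le> (\<integral>\<^sup>+i. 5 * emeasure \<nu> (?I i) \<partial>count_space C)"
  proof (rule nn_integral_mono)
    fix i assume "i \<in> space (count_space C)"
    then have i: "i \<in> E" using C(2) by auto
    have "ennreal A * ennreal (5 * (2 * k i)) = ennreal (5 * (2 * k i * A))"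
      using A by (simp add: ennreal_mult'[symmetric] mult_ac)
    also have "\<dots> \<le> ennreal (5 * integral (?I i) \<phi>)"
      using k[OF i] by (intro ennreal_leI) linarith
    also have "\<dots> = 5 * ennreal (integral (?I i) \<phi>)" by (simp add: ennreal_mult')
    also have "\<dots> = 5 * emeasure \<nu> (?I i)"
      by (simp add: \<nu> nn_integral_interval_eq_integral[OF c nn])
    finally show "ennreal A * ennreal (5 * (2 * k i)) \<le> 5 * emeasure \<nu> (?I i)" .
  qed
  also have "\<dots> = 5 * (\<integral>\<^sup>+i. emeasure \<nu> (?I i) \<partial>count_space C)" by (simp add: nn_integral_cmult)
  also have "(\<integral>\<^sup>+i. emeasure \<nu> (?I i) \<partial>count_space C) = emeasure \<nu> (\<Union>i\<in>C. ?I i)"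
  proof (rule emeasure_UN_countable[symmetric])
    show "disjoint_family_on ?I C"
      using C(3) by (auto simp: disjoint_family_on_def pairwise_def disjnt_def cball_eq_atLeastAtMost)
  qed (use C(1) in \<open>auto simp: \<nu>_def\<close>)
  also have "emeasure \<nu> (\<Union>i\<in>C. ?I i) \<le> emeasure \<nu> U"
    using k C(2) U by (intro emeasure_mono) (auto simp: \<nu>_def)
  also have "emeasure \<nu> U = (\<integral>\<^sup>+t\<in>U. ennreal (\<phi> t) \<partial>lborel)" by (rule \<nu>[OF U])
  finally show ?thesis by (simp add: mult_left_mono)
qed

text \<open>
  A decreasing weight is a superposition of indicators of intervals \<open>[0, k]\<close>, so the bound on the
  means over these intervals is inherited. The proof integrates by parts:
  the derivative of \<open>q D\<close> is \<open>q' D + q (\<psi> - c)\<close>, where \<open>q' D\<close> is nonnegative and the boundary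
  term \<open>q b * D b\<close> is nonpositive.
\<close>

lemma decreasing_weight_integral_le:
  fixes q q' \<psi> :: "real \<Rightarrow> real"
  assumes b: "0 \<le> b" and \<psi>: "continuous_on {0..b} \<psi>" and q0: "0 \<le> q b"
    and dq: "\<And>x. x \<in> {0..b} \<Longrightarrow> (q has_real_derivative q' x) (at x within {0..b})"
    and q': "\<And>x. x \<in> {0..b} \<Longrightarrow> q' x \<le> 0"
    and le: "\<And>k. 0 < k \<Longrightarrow> k \<le> b \<Longrightarrow> integral {0..k} \<psi> \<le> c * k"
  shows "integral {0..b} (\<lambda>x. q x * \<psi> x) \<le> c * integral {0..b} q"
proof -
  define D where "D k = integral {0..k} \<psi> - c * k" for k
  have le0: "D k \<le> 0" if "k \<in> {0..b}" for k
    using le[of k] that by (cases "k = 0") (auto simp: D_def)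
  have qc: "continuous_on {0..b} q" using dq by (meson DERIV_continuous_on)
  have "((\<lambda>x. q x * D x) has_vector_derivative q' x * D x + q x * (\<psi> x - c)) (at x within {0..b})"
    if x: "x \<in> {0..b}" for x
  proof -
    have "(D has_real_derivative \<psi> x - c) (at x within {0..b})"
      unfolding D_def using integral_has_vector_derivative[OF \<psi> x]
      by (auto intro!: derivative_eq_intros simp: has_real_derivative_iff_has_vector_derivative)
    from DERIV_mult[OF dq[OF x] this] show ?thesis
      by (simp add: has_real_derivative_iff_has_vector_derivative algebra_simps)
  qed
  from fundamental_theorem_of_calculus[OF b this]
  have "((\<lambda>x. q' x * D x + q x * (\<psi> x - c)) has_integral q b * D b) {0..b}"
    by (simp add: D_def)
  moreover have i: "(\<lambda>x. q x * (\<psi> x - c)) integrable_on {0..b}"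
    by (intro integrable_continuous_real continuous_intros qc \<psi>)
  ultimately have "integral {0..b} (\<lambda>x. q x * (\<psi> x - c)) \<le> q b * D b"
    using mult_nonpos_nonpos[OF q' le0] by (intro has_integral_le[OF integrable_integral]) auto
  also have "\<dots> \<le> 0" using q0 le0 b by (intro mult_nonneg_nonpos) auto
  also have "integral {0..b} (\<lambda>x. q x * (\<psi> x - c)) = integral {0..b} (\<lambda>x. q x * \<psi> x - c * q x)"
    by (intro integral_cong) (simp add: algebra_simps)
  also have "\<dots> = integral {0..b} (\<lambda>x. q x * \<psi> x) - c * integral {0..b} q"
    by (subst integral_diff) (auto intro!: integrable_continuous_real continuous_intros qc \<psi>)
  finally show ?thesis by simp
qed

lemma has_integral_reflect_shift:
  fixes f :: "real \<Rightarrow> real"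
  assumes "(f has_integral i) {a..b}"
  shows "((\<lambda>x. f (c - x)) has_integral i) {c-b..c-a}"
proof (cases "a \<le> b")
  case True
  have im: "(\<lambda>x. c - x) ` {a..b} = {c-b..c-a}"
  proof -
    have "(\<lambda>x. c - x) ` {a..b} \<subseteq> {c-b..c-a}" by auto
    moreover have "x \<in> (\<lambda>x. c - x) ` {a..b}" if "x \<in> {c-b..c-a}" for x
      using that by (intro image_eqI[of _ _ "c - x"]) auto
    ultimately show ?thesis by blast
  qed
  from has_integral_affinity[of f i a b "-1" c] assms im show ?thesis by simp
next
  case False
  with assms show ?thesis by simp
qed

lemma has_integral_shift:
  fixes f :: "real \<Rightarrow> real"
  assumes "(f has_integral i) {a..b}"
  shows "((\<lambda>x. f (c + x)) has_integral i) {a-c..b-c}"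
  using has_integral_affinity'[of f i a b 1 c] assms by (simp add: add.commute)

lemma integral_symmetric_interval:
  fixes \<phi> :: "real \<Rightarrow> real"
  assumes c: "continuous_on UNIV \<phi>" and k: "0 \<le> k"
  shows "integral {0..k} (\<lambda>s. \<phi> (\<theta> + s) + \<phi> (\<theta> - s)) = integral {\<theta>-k..\<theta>+k} \<phi>"
proof -
  have hi: "(\<phi> has_integral integral {a..b} \<phi>) {a..b}" for a b
    by (intro integrable_integral integrable_continuous_real continuous_on_subset[OF c]) auto
  have "((\<lambda>s. \<phi> (\<theta> + s)) has_integral integral {\<theta>..\<theta>+k} \<phi>) {0..k}"
    using has_integral_shift[OF hi[of \<theta> "\<theta> + k"], of \<theta>] by simp
  moreover have "((\<lambda>s. \<phi> (\<theta> - s)) has_integral integral {\<theta>-k..\<theta>} \<phi>) {0..k}"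
    using has_integral_reflect_shift[OF hi[of "\<theta> - k" \<theta>], of \<theta>] by simp
  ultimately have "((\<lambda>s. \<phi> (\<theta> + s) + \<phi> (\<theta> - s)) has_integral integral {\<theta>..\<theta>+k} \<phi> + integral {\<theta>-k..\<theta>} \<phi>) {0..k}"
    by (rule has_integral_add)
  moreover have "integral {\<theta>-k..\<theta>} \<phi> + integral {\<theta>..\<theta>+k} \<phi> = integral {\<theta>-k..\<theta>+k} \<phi>"
    using k by (intro Henstock_Kurzweil_Integration.integral_combine integrable_continuous_real continuous_on_subset[OF c]) auto
  ultimately show ?thesis by (simp add: integral_unique add.commute)
qed

lemma poisson_kernel_real:
  assumes "0 \<le> r" "r < 1"
  shows "poisson_kernel (complex_of_real r) t = (1 - r\<^sup>2) / (1 - 2 * r * cos t + r\<^sup>2)"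
proof -
  have "(cmod (cis t - complex_of_real r))\<^sup>2 = (cos t)\<^sup>2 + (sin t)\<^sup>2 - 2 * r * cos t + r\<^sup>2"
    by (simp only: cmod_power2) (simp add: power2_eq_square algebra_simps)
  then show ?thesis using assms by (simp add: poisson_kernel_eq)
qed

lemma norm_le_poisson_integral:
  assumes h: "h holomorphic_on cball 0 1" and z: "z \<in> unit_disc"
  shows "cmod (h z) \<le> poisson_integral (\<lambda>t. cmod (h (cis t))) z"
proof -
  obtain c where c: "cmod c = 1" "c * h z = complex_of_real (cmod (h z))"
  proof (cases "h z = 0")
    case True
    then show thesis by (intro that[of 1]) auto
  next
    case False
    then show thesis
      by (intro that[of "cnj (h z) / cmod (h z)"])
        (auto simp: norm_divide field_simps complex_norm_square[symmetric] power2_eq_square)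
  qed
  have hc: "continuous_on {0..2*pi} (\<lambda>t. h (cis t))"
    by (intro continuous_on_compose2[OF holomorphic_on_imp_continuous_on[OF h]] continuous_intros) auto
  have "cmod (h z) = Re (c * h z)" by (simp add: c)
  also have "\<dots> = poisson_integral (\<lambda>t. Re (c * h (cis t))) z"
    by (intro poisson_formula z holomorphic_intros h)
  also have "\<dots> \<le> poisson_integral (\<lambda>t. cmod (h (cis t))) z"
  proof (rule poisson_integral_mono[OF z])
    show "Re (c * h (cis t)) \<le> cmod (h (cis t))" for t
      using complex_Re_le_cmod[of "c * h (cis t)"] by (simp add: norm_mult c)
  qed (intro continuous_integrable_circle continuous_intros hc)+
  finally show ?thesis .
qed

text \<open>
  The Poisson kernel is even and decreasing in the angular distance, so Poisson means are dominated
  by the largest mean over symmetric intervals. This reduces the radial maximal function to the maximal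
  function of Hardy and Littlewood.
\<close>

lemma norm_le_of_interval_means:
  assumes h: "h holomorphic_on cball 0 1" and r: "0 \<le> r" "r < 1"
    and le: "\<And>k. 0 < k \<Longrightarrow> k \<le> pi \<Longrightarrow> integral {\<theta>-k..\<theta>+k} (\<lambda>t. cmod (h (cis t))) \<le> 2 * k * A"
  shows "cmod (h (complex_of_real r * cis \<theta>)) \<le> A"
proof -
  define \<phi> where "\<phi> t = cmod (h (cis t))" for t
  define q where "q t = (1 - r\<^sup>2) / (1 - 2 * r * cos t + r\<^sup>2)" for t
  have rd: "complex_of_real r \<in> unit_disc" using r by simp
  have \<phi>c: "continuous_on UNIV \<phi>" unfolding \<phi>_def
    by (intro continuous_intros continuous_on_compose2[OF holomorphic_on_imp_continuous_on[OF h]]) auto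
  have den: "0 < 1 - 2 * r * cos t + r\<^sup>2" for t
  proof -
    have "2 * r * cos t \<le> 2 * r * 1" using r by (intro mult_left_mono) auto
    moreover have "0 < (1 - r)\<^sup>2" using r by simp
    ultimately show ?thesis by (simp add: power2_eq_square algebra_simps)
  qed
  have q_eq: "poisson_kernel (complex_of_real r) t = q t" for t
    using poisson_kernel_real[OF r] by (simp add: q_def)
  have q0: "0 \<le> q t" for t using poisson_kernel_nonneg[OF rd, of t] by (simp add: q_eq)
  have qc: "continuous_on S q" for S
    unfolding q_def using den by (intro continuous_intros) (auto simp: less_imp_neq[symmetric])
  \<comment> \<open>fold the circle at the point opposite to the one of interest\<close>
  have fold: "(LINT t|circle_measure. q t * f t) = integral {0..pi} (\<lambda>t. q t * (f t + f (2 * pi - t)))"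
    if fc: "continuous_on UNIV f" for f
  proof -
    have c: "continuous_on S (\<lambda>t. q t * f t)" for S
      by (intro continuous_intros qc continuous_on_subset[OF fc]) auto
    have "(LINT t|circle_measure. q t * f t) = integral {0..2*pi} (\<lambda>t. q t * f t)"
      by (intro lebesgue_integral_eq_integral continuous_integrable_circle c) auto
    also have "\<dots> = integral {0..pi} (\<lambda>t. q t * f t) + integral {pi..2*pi} (\<lambda>t. q t * f t)"
      by (intro Henstock_Kurzweil_Integration.integral_combine[symmetric] integrable_continuous_real c) auto
    also have "integral {pi..2*pi} (\<lambda>t. q t * f t) = integral {0..pi} (\<lambda>t. q (2 * pi - t) * f (2 * pi - t))"
      using has_integral_reflect_shift[OF integrable_integral[OF integrable_continuous_real[OF c]], of "2*pi" pi "2*pi"]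
      by (simp add: integral_unique)
    also have "(\<lambda>t. q (2 * pi - t) * f (2 * pi - t)) = (\<lambda>t. q t * f (2 * pi - t))"
      by (simp add: q_def cos_diff)
    also have "integral {0..pi} (\<lambda>t. q t * f t) + integral {0..pi} (\<lambda>t. q t * f (2 * pi - t))
        = integral {0..pi} (\<lambda>t. q t * f t + q t * f (2 * pi - t))"
      by (intro integral_add[symmetric] integrable_continuous_real continuous_intros qc
          continuous_on_compose2[OF fc]) auto
    finally show ?thesis by (simp add: algebra_simps)
  qed
  have "cmod (h (complex_of_real r * cis \<theta>)) \<le> poisson_integral (\<lambda>t. cmod (h (cis t * cis \<theta>))) (complex_of_real r)"
  proof (rule norm_le_poisson_integral[of "\<lambda>w. h (w * cis \<theta>)", OF _ rd])
    show "(\<lambda>w. h (w * cis \<theta>)) holomorphic_on cball 0 1"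
      by (rule holomorphic_on_compose_gen[OF _ h, unfolded o_def]) (auto intro!: holomorphic_intros simp: norm_mult)
  qed
  also have "\<dots> = (LINT t|circle_measure. q t * \<phi> (\<theta> + t)) / (2 * pi)"
    by (simp add: poisson_integral_def q_eq \<phi>_def cis_mult add.commute)
  also have "(LINT t|circle_measure. q t * \<phi> (\<theta> + t))
      = integral {0..pi} (\<lambda>t. q t * (\<phi> (\<theta> + t) + \<phi> (\<theta> + (2 * pi - t))))"
    by (intro fold continuous_on_compose2[OF \<phi>c] continuous_intros) auto
  also have "(\<lambda>t. \<phi> (\<theta> + (2 * pi - t))) = (\<lambda>t. \<phi> (\<theta> - t))"
  proof
    fix t
    have "cis (\<theta> + (2 * pi - t)) = cis (\<theta> - t) * cis (2 * pi)" by (simp only: cis_mult) (simp add: algebra_simps)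
    then show "\<phi> (\<theta> + (2 * pi - t)) = \<phi> (\<theta> - t)" by (simp add: \<phi>_def)
  qed
  then have "integral {0..pi} (\<lambda>t. q t * (\<phi> (\<theta> + t) + \<phi> (\<theta> + (2 * pi - t))))
      = integral {0..pi} (\<lambda>t. q t * (\<phi> (\<theta> + t) + \<phi> (\<theta> - t)))"
    by (metis (no_types, lifting))
  also have "\<dots> \<le> 2 * A * integral {0..pi} q"
  proof (rule decreasing_weight_integral_le)
    let ?q' = "\<lambda>t. - (1 - r\<^sup>2) * (2 * r * sin t) / (1 - 2 * r * cos t + r\<^sup>2)\<^sup>2"
    show "(q has_real_derivative ?q' x) (at x within {0..pi})" for x
      unfolding q_def using den[of x]
      by (auto intro!: derivative_eq_intros simp: power2_eq_square field_simps)
    show "?q' x \<le> 0" if "x \<in> {0..pi}" for x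
    proof -
      have "0 \<le> (1 - r\<^sup>2) * (2 * r * sin x)"
        using that r sin_ge_zero[of x] by (intro mult_nonneg_nonneg) (auto simp: abs_square_le_1)
      then have "- (1 - r\<^sup>2) * (2 * r * sin x) \<le> 0" by linarith
      then show ?thesis by (intro divide_nonpos_nonneg) auto
    qed
    show "continuous_on {0..pi} (\<lambda>t. \<phi> (\<theta> + t) + \<phi> (\<theta> - t))"
      by (intro continuous_intros continuous_on_compose2[OF \<phi>c]) auto
    show "integral {0..k} (\<lambda>t. \<phi> (\<theta> + t) + \<phi> (\<theta> - t)) \<le> 2 * A * k" if "0 < k" "k \<le> pi" for k
      using le[OF that] that integral_symmetric_interval[OF \<phi>c, of k \<theta>]
      by (simp add: \<phi>_def[abs_def] mult_ac)
  qed (use q0 in auto)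
  also have "integral {0..pi} q = pi"
  proof -
    have "2 * integral {0..pi} q = integral {0..pi} (\<lambda>t. q t * (1 + 1))"
      by (simp add: mult.commute)
    also have "\<dots> = (LINT t|circle_measure. q t * 1)"
      by (rule fold[symmetric]) auto
    also have "\<dots> = 2 * pi"
      using poisson_integral_const[OF rd, of 1] by (simp add: poisson_integral_def q_eq)
    finally show ?thesis by simp
  qed
  finally show ?thesis by (simp add: field_simps)
qed

lemma open_radial_exceeds:
  assumes "continuous_on unit_disc g"
  shows "open {\<theta>. \<exists>r\<in>{0..<1}. \<eta> < cmod (g (complex_of_real r * cis \<theta>))}"
proof -
  have "open {\<theta>. \<eta> < cmod (g (complex_of_real r * cis \<theta>))}" if "r \<in> {0..<1}" for r
    using that by (intro open_Collect_less continuous_intros continuous_on_compose2[OF assms])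
      (auto simp: norm_mult)
  then have "open (\<Union>r\<in>{0..<1}. {\<theta>. \<eta> < cmod (g (complex_of_real r * cis \<theta>))})" by auto
  moreover have "(\<Union>r\<in>{0..<1}. {\<theta>. \<eta> < cmod (g (complex_of_real r * cis \<theta>))})
      = {\<theta>. \<exists>r\<in>{0..<1}. \<eta> < cmod (g (complex_of_real r * cis \<theta>))}" by auto
  ultimately show ?thesis by simp
qed

text \<open>
  The constant is \<open>15 = 5 \<cdot> 3\<close>: 5 from the covering lemma, and 3 because intervals of radius at most
  \<open>\<pi>\<close> centred in \<open>[0, 2\<pi>]\<close> stay within the three periods \<open>[-2\<pi>, 4\<pi>]\<close>.
\<close>

lemma maximal_weak_type_closed_disc:
  assumes h: "h holomorphic_on cball 0 1" and l: "0 < \<eta>"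
  shows "ennreal \<eta> * emeasure lborel ({0..2*pi} \<inter> {\<theta>. \<exists>r\<in>{0..<1}. \<eta> < cmod (h (complex_of_real r * cis \<theta>))})
    \<le> ennreal (15 * (LINT t|circle_measure. cmod (h (cis t))))"
proof -
  define \<phi> where "\<phi> t = cmod (h (cis t))" for t
  have \<phi>c: "continuous_on UNIV \<phi>" unfolding \<phi>_def
    by (intro continuous_intros continuous_on_compose2[OF holomorphic_on_imp_continuous_on[OF h]]) auto
  have io: "\<phi> integrable_on {a..b}" for a b
    by (intro integrable_continuous_real continuous_on_subset[OF \<phi>c]) auto
  have per: "\<phi> (2 * pi + t) = \<phi> t" for t
    using cis_mult[of "2 * pi" t] by (simp add: \<phi>_def)
  have "ennreal \<eta> * emeasure lborel ({0..2*pi} \<inter> {\<theta>. \<exists>r\<in>{0..<1}. \<eta> < cmod (h (complex_of_real r * cis \<theta>))})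
      \<le> 5 * (\<integral>\<^sup>+t\<in>{-(2*pi)..4*pi}. ennreal (\<phi> t) \<partial>lborel)"
  proof (rule covering_weak_type[OF \<phi>c _ l, of _ pi])
    have "continuous_on unit_disc h"
      by (rule continuous_on_subset[OF holomorphic_on_imp_continuous_on[OF h]]) auto
    from open_radial_exceeds[OF this, of \<eta>]
    show "{0..2*pi} \<inter> {\<theta>. \<exists>r\<in>{0..<1}. \<eta> < cmod (h (complex_of_real r * cis \<theta>))} \<in> sets borel"
      by (intro sets.Int) (auto intro: borel_open)
    fix \<theta> assume \<theta>: "\<theta> \<in> {0..2*pi} \<inter> {\<theta>. \<exists>r\<in>{0..<1}. \<eta> < cmod (h (complex_of_real r * cis \<theta>))}"
    then obtain r where r: "0 \<le> r" "r < 1" "\<not> cmod (h (complex_of_real r * cis \<theta>)) \<le> \<eta>" by auto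
    then obtain k where k: "0 < k" "k \<le> pi" "2 * k * \<eta> < integral {\<theta>-k..\<theta>+k} \<phi>"
      using norm_le_of_interval_means[OF h r(1,2), of \<theta> \<eta>] unfolding \<phi>_def[abs_def] by (meson not_le)
    have "{\<theta>-k..\<theta>+k} \<subseteq> {-(2*pi)..4*pi}" using \<theta> k(1,2) pi_gt_zero by auto
    with k show "\<exists>k. 0 < k \<and> k \<le> pi \<and> {\<theta>-k..\<theta>+k} \<subseteq> {-(2*pi)..4*pi} \<and> 2 * k * \<eta> < integral {\<theta>-k..\<theta>+k} \<phi>"
      by blast
  qed (auto simp: \<phi>_def)
  also have "(\<integral>\<^sup>+t\<in>{-(2*pi)..4*pi}. ennreal (\<phi> t) \<partial>lborel) = ennreal (integral {-(2*pi)..4*pi} \<phi>)"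
    by (rule nn_integral_interval_eq_integral[OF \<phi>c]) (simp add: \<phi>_def)
  also have "integral {-(2*pi)..4*pi} \<phi> = integral {-(2*pi)..0} \<phi> + integral {0..4*pi} \<phi>"
    by (intro Henstock_Kurzweil_Integration.integral_combine[symmetric] io) auto
  also have "integral {0..4*pi} \<phi> = integral {0..2*pi} \<phi> + integral {2*pi..4*pi} \<phi>"
    by (intro Henstock_Kurzweil_Integration.integral_combine[symmetric] io) auto
  also have "integral {-(2*pi)..0} \<phi> = integral {0..2*pi} \<phi>"
    using has_integral_shift[OF integrable_integral[OF io[of 0 "2*pi"]], of "2*pi"]
    by (simp add: per integral_unique)
  also have "integral {2*pi..4*pi} \<phi> = integral {0..2*pi} \<phi>"
    using has_integral_shift[OF integrable_integral[OF io[of "2*pi" "4*pi"]], of "2*pi"]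
    by (simp add: per integral_unique)
  also have "integral {0..2*pi} \<phi> = (LINT t|circle_measure. cmod (h (cis t)))"
    unfolding \<phi>_def[symmetric]
    by (intro lebesgue_integral_eq_integral[symmetric] continuous_integrable_circle continuous_on_subset[OF \<phi>c]) auto
  also have "5 * ennreal (X + (X + X)) = ennreal (15 * X)" for X :: real
  proof -
    have "ennreal (5 * (X + (X + X))) = 5 * ennreal (X + (X + X))" by (simp only: ennreal_mult' ennreal_numeral zero_le_numeral)
    then show ?thesis by simp
  qed
  finally show ?thesis .
qed

text \<open>
  The exceptional sets of the dilations \<open>g (s w)\<close> increase with \<open>s\<close> to that of \<open>g\<close>.
\<close>

lemma maximal_weak_type:
  assumes g: "g holomorphic_on unit_disc" and l: "0 < \<eta>"
    and M: "\<And>s. 0 \<le> s \<Longrightarrow> s < 1 \<Longrightarrow> (LINT t|circle_measure. cmod (g (complex_of_real s * cis t))) \<le> M"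
  shows "ennreal \<eta> * emeasure lborel ({0..2*pi} \<inter> {\<theta>. \<exists>r\<in>{0..<1}. \<eta> < cmod (g (complex_of_real r * cis \<theta>))})
    \<le> ennreal (15 * M)"
proof -
  define s :: "nat \<Rightarrow> real" where "s n = 1 - 1 / real (Suc n)" for n
  have s: "0 \<le> s n" "s n < 1" for n by (auto simp: s_def field_simps)
  define E where "E n = {0..2*pi} \<inter> {\<theta>. \<exists>r\<in>{0..<1}. \<eta> < cmod (g (complex_of_real (s n * r) * cis \<theta>))}" for n
  have gs: "(\<lambda>w. g (complex_of_real (s n) * w)) holomorphic_on cball 0 1" for n
    by (rule holomorphic_dilation[OF g s])
  have En: "E n = {0..2*pi} \<inter> {\<theta>. \<exists>r\<in>{0..<1}. \<eta> < cmod (g (complex_of_real (s n) * (complex_of_real r * cis \<theta>)))}" for n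
    by (simp add: E_def mult.assoc)
  have Eb: "E n \<in> sets lborel" for n
    using open_radial_exceeds[OF holomorphic_on_imp_continuous_on[OF holomorphic_on_subset[OF gs[of n]]], of \<eta>]
    unfolding En by (intro sets.Int) (auto intro: borel_open)
  have En_le: "ennreal \<eta> * emeasure lborel (E n) \<le> ennreal (15 * M)" for n
  proof -
    have "ennreal \<eta> * emeasure lborel (E n) \<le> ennreal (15 * (LINT t|circle_measure. cmod (g (complex_of_real (s n) * cis t))))"
      unfolding En by (rule maximal_weak_type_closed_disc[OF gs l])
    also have "\<dots> \<le> ennreal (15 * M)" using M[OF s] by (intro ennreal_leI) auto
    finally show ?thesis .
  qed
  have inc: "incseq E"
  proof (rule monoI, rule subsetI)
    fix m n :: nat and \<theta> assume mn: "m \<le> n" and "\<theta> \<in> E m"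
    then obtain r where \<theta>: "\<theta> \<in> {0..2*pi}" and r: "0 \<le> r" "r < 1" "\<eta> < cmod (g (complex_of_real (s m * r) * cis \<theta>))"
      by (auto simp: E_def)
    have smn: "s m \<le> s n" using mn by (auto simp: s_def field_simps)
    show "\<theta> \<in> E n"
    \<comment> \<open>the radius on the larger dilation is the quotient \<open>s m * r / s n\<close>, and \<open>s 0 = 0\<close>\<close>
    proof (cases "s m = 0")
      case True
      then have "s n * 0 = s m * r" by simp
      then show ?thesis unfolding E_def using \<theta> r
        by (auto intro!: bexI[of _ 0] simp: True)
    next
      case False
      then have sm: "0 < s m" "0 < s n" using s(1)[of m] smn by auto
      have "s m * r / s n < 1"
      proof -
        have "s m * r \<le> s n * r" using smn r by (intro mult_right_mono) auto
        also have "\<dots> < s n * 1" using sm r by (intro mult_strict_left_mono) auto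
        finally show ?thesis using sm by simp
      qed
      then show ?thesis unfolding E_def using \<theta> r sm
        by (auto intro!: bexI[of _ "s m * r / s n"])
    qed
  qed
  have "{0..2*pi} \<inter> {\<theta>. \<exists>r\<in>{0..<1}. \<eta> < cmod (g (complex_of_real r * cis \<theta>))} \<subseteq> (\<Union>n. E n)"
  proof
    fix \<theta> assume "\<theta> \<in> {0..2*pi} \<inter> {\<theta>. \<exists>r\<in>{0..<1}. \<eta> < cmod (g (complex_of_real r * cis \<theta>))}"
    then obtain r where \<theta>: "\<theta> \<in> {0..2*pi}" and r: "0 \<le> r" "r < 1" "\<eta> < cmod (g (complex_of_real r * cis \<theta>))" by auto
    obtain n where n: "1 / real (Suc n) < 1 - r" using r(2) nat_approx_posE[of "1 - r"] by auto
    then have rs: "r < s n" by (simp add: s_def)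
    then have "\<theta> \<in> E n" unfolding E_def using \<theta> r
      by (auto intro!: bexI[of _ "r / s n"])
    then show "\<theta> \<in> (\<Union>n. E n)" by blast
  qed
  then have "emeasure lborel ({0..2*pi} \<inter> {\<theta>. \<exists>r\<in>{0..<1}. \<eta> < cmod (g (complex_of_real r * cis \<theta>))})
      \<le> emeasure lborel (\<Union>n. E n)"
    using Eb by (intro emeasure_mono) auto
  also have "\<dots> = (SUP n. emeasure lborel (E n))"
    using Eb inc by (intro SUP_emeasure_incseq[symmetric]) auto
  finally have "ennreal \<eta> * emeasure lborel ({0..2*pi} \<inter> {\<theta>. \<exists>r\<in>{0..<1}. \<eta> < cmod (g (complex_of_real r * cis \<theta>))})
      \<le> (SUP n. ennreal \<eta> * emeasure lborel (E n))"
    by (simp add: SUP_mult_left_ennreal[symmetric] mult_left_mono)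
  also have "\<dots> \<le> ennreal (15 * M)" by (intro SUP_least En_le)
  finally show ?thesis .
qed

lemma parseval_polynomial:
  fixes a :: "nat \<Rightarrow> complex"
  shows "(LINT t|circle_measure. (cmod (\<Sum>n<N. a n * cis t ^ n))\<^sup>2) = 2 * pi * (\<Sum>n<N. (cmod (a n))\<^sup>2)"
proof (induction N)
  case (Suc N)
  let ?P = "\<lambda>t. \<Sum>n<N. a n * cis t ^ n" and ?T = "\<lambda>t. a N * cis t ^ N"
  let ?R = "\<lambda>w. \<Sum>n<N. cnj (a n) * a N * w ^ (N - n)"
  \<comment> \<open>the cross term is a polynomial in \<open>cis t\<close> without constant term, so its mean vanishes\<close>
  have cr: "cnj (?P t) * ?T t = ?R (cis t)" for t
  proof -
    have "cnj (cis t) ^ n * cis t ^ N = cis t ^ (N - n)" if "n < N" for n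
    proof -
      have "cis t ^ N = cis t ^ n * cis t ^ (N - n)" using that by (simp flip: power_add)
      moreover have "cnj (cis t) ^ n * cis t ^ n = 1"
        by (simp add: power_mult_distrib[symmetric] cis_cnj cis_mult)
      ultimately show ?thesis by (simp add: mult.assoc[symmetric])
    qed
    then have "(\<Sum>n<N. cnj (a n) * a N * (cnj (cis t) ^ n * cis t ^ N)) = ?R (cis t)"
      by (intro sum.cong) auto
    then show ?thesis by (simp add: sum_distrib_left sum_distrib_right mult_ac)
  qed
  have "?R 0 = 0" by (auto intro!: sum.neutral)
  moreover have "?R holomorphic_on cball 0 1" by (intro holomorphic_intros)
  ultimately have R0: "(LINT t|circle_measure. ?R (cis t)) = 0"
    using mean_value_circle[of ?R] by simp
  have "integrable circle_measure (\<lambda>t. ?R (cis t))"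
    by (intro continuous_integrable_circle continuous_intros)
  from integral_Re[OF this] R0
  have R1: "(LINT t|circle_measure. Re (?R (cis t))) = 0" by simp
  have e: "(cmod (\<Sum>n<Suc N. a n * cis t ^ n))\<^sup>2 = (cmod (?P t))\<^sup>2 + (cmod (a N))\<^sup>2 + 2 * Re (?R (cis t))" for t
  proof -
    have "(cmod (x + y))\<^sup>2 = (cmod x)\<^sup>2 + (cmod y)\<^sup>2 + 2 * Re (cnj x * y)" for x y
      by (simp only: cmod_power2) (simp add: power2_eq_square algebra_simps)
    from this[of "?P t" "?T t", unfolded cr] show ?thesis
      by (simp only: sum.lessThan_Suc norm_mult norm_power norm_cis power_one mult_1_right)
  qed
  have "(LINT t|circle_measure. (cmod (\<Sum>n<Suc N. a n * cis t ^ n))\<^sup>2)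
      = (LINT t|circle_measure. (cmod (?P t))\<^sup>2) + (LINT t|circle_measure. (cmod (a N))\<^sup>2) + 2 * (LINT t|circle_measure. Re (?R (cis t)))"
    unfolding e
    by (subst Bochner_Integration.integral_add Bochner_Integration.integral_add integral_mult_right_zero;
        (intro continuous_integrable_circle continuous_intros)?)+ simp
  also have "\<dots> = 2 * pi * (\<Sum>n<N. (cmod (a n))\<^sup>2) + 2 * pi * (cmod (a N))\<^sup>2"
    using R1 Suc by (simp add: measure_restrict_space)
  finally show ?case by (simp add: algebra_simps)
qed simp

lemma parseval:
  fixes a :: "nat \<Rightarrow> complex"
  assumes sums: "\<And>z. z \<in> unit_disc \<Longrightarrow> (\<lambda>n. a n * z ^ n) sums f z" and s: "0 \<le> s" "s < 1"
  shows "(\<lambda>n. 2 * pi * ((cmod (a n))\<^sup>2 * s ^ (2 * n))) sums (LINT t|circle_measure. (cmod (f (complex_of_real s * cis t)))\<^sup>2)"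
proof -
  let ?z = "\<lambda>t. complex_of_real s * cis t"
  define C where "C = (\<Sum>n. cmod (a n) * s ^ n)"
  obtain u where u: "s < u" "u < 1" using dense[OF s(2)] by blast
  have "summable (\<lambda>n. a n * complex_of_real u ^ n)"
    using sums[of "complex_of_real u"] u s by (auto simp: sums_iff)
  from powser_insidea[OF this, of "complex_of_real s"]
  have sc: "summable (\<lambda>n. cmod (a n) * s ^ n)" using s u by (simp add: norm_mult norm_power)
  have le: "cmod (\<Sum>n<N. a n * ?z t ^ n) \<le> C" for N t
  proof -
    have "cmod (\<Sum>n<N. a n * ?z t ^ n) \<le> (\<Sum>n<N. cmod (a n * ?z t ^ n))" by (rule norm_sum)
    also have "\<dots> = (\<Sum>n<N. cmod (a n) * s ^ n)" using s by (simp add: norm_mult norm_power)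
    also have "\<dots> \<le> C" unfolding C_def using s by (intro sum_le_suminf sc) auto
    finally show ?thesis .
  qed
  have "(\<lambda>N. LINT t|circle_measure. (cmod (\<Sum>n<N. a n * ?z t ^ n))\<^sup>2)
      \<longlonglongrightarrow> (LINT t|circle_measure. (cmod (f (?z t)))\<^sup>2)"
  proof (rule integral_dominated_convergence[where w = "\<lambda>_. C\<^sup>2"])
    have z: "?z t \<in> unit_disc" for t using s by (intro radius_cis_in_disc)
    have lim: "(\<lambda>N. \<Sum>n<N. a n * ?z t ^ n) \<longlonglongrightarrow> f (?z t)" for t
      using sums[OF z] by (simp only: sums_def)
    show m: "(\<lambda>t. (cmod (\<Sum>n<N. a n * ?z t ^ n))\<^sup>2) \<in> borel_measurable circle_measure" for N
      by (intro continuous_imp_measurable_on_sets_lebesgue continuous_intros) auto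
    have lim2: "(\<lambda>N. (cmod (\<Sum>n<N. a n * ?z t ^ n))\<^sup>2) \<longlonglongrightarrow> (cmod (f (?z t)))\<^sup>2" for t
      by (intro tendsto_intros lim)
    show "(\<lambda>t. (cmod (f (?z t)))\<^sup>2) \<in> borel_measurable circle_measure"
      by (rule borel_measurable_LIMSEQ_metric[OF m lim2])
    show "integrable circle_measure (\<lambda>_. C\<^sup>2)"
      by (intro continuous_integrable_circle continuous_intros)
    show "AE t in circle_measure. (\<lambda>N. (cmod (\<Sum>n<N. a n * ?z t ^ n))\<^sup>2) \<longlonglongrightarrow> (cmod (f (?z t)))\<^sup>2"
      using lim2 by simp
    show "AE t in circle_measure. norm ((cmod (\<Sum>n<N. a n * ?z t ^ n))\<^sup>2) \<le> C\<^sup>2" for N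
      using le by (auto intro!: power_mono)
  qed
  moreover have "(s ^ n)\<^sup>2 = (s\<^sup>2) ^ n" for n by (simp add: power_mult[symmetric] mult.commute)
  then have "(LINT t|circle_measure. (cmod (\<Sum>n<N. a n * ?z t ^ n))\<^sup>2) = (\<Sum>n<N. 2 * pi * ((cmod (a n))\<^sup>2 * s ^ (2 * n)))" for N
    using parseval_polynomial[of "\<lambda>n. a n * complex_of_real s ^ n" N] s
    by (simp add: power_mult_distrib norm_mult norm_power mult.assoc sum_distrib_left power_mult power_even_abs power_commutes)
  ultimately show ?thesis by (simp add: sums_def)
qed

section \<open>Radial limits of bounded holomorphic functions\<close>

lemma filter_limit_if_cauchy:
  fixes f :: "'a \<Rightarrow> 'b::complete_space"
  assumes "F \<noteq> bot"
    and "\<And>e. 0 < e \<Longrightarrow> \<exists>P. eventually P F \<and> (\<forall>x y. P x \<and> P y \<longrightarrow> dist (f x) (f y) < e)"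
  shows "\<exists>l. (f \<longlongrightarrow> l) F"
proof -
  have "cauchy_filter (filtermap f F)"
    using assms(2) by (simp add: cauchy_filter_metric_filtermap)
  moreover have "filtermap f F \<noteq> bot" using assms(1) by (simp add: filtermap_bot_iff)
  ultimately show ?thesis
    using complete_UNIV unfolding complete_uniform filterlim_def by auto
qed

lemma series_tail_tendsto_0:
  fixes c :: "nat \<Rightarrow> real"
  assumes "summable c"
  shows "(\<lambda>N. \<Sum>n. if n < N then 0 else c n) \<longlonglongrightarrow> 0"
proof -
  have "(\<lambda>n. c n - (if n < N then c n else 0)) sums (suminf c - (\<Sum>n<N. c n))" for N
    using sums_diff[OF summable_sums[OF assms] sums_If_finite[of "\<lambda>n. n < N" c]]
    by (simp add: lessThan_def)
  moreover have "(\<lambda>n. c n - (if n < N then c n else 0)) = (\<lambda>n. if n < N then 0 else c n)" for N by auto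
  ultimately have "(\<Sum>n. if n < N then 0 else c n) = suminf c - (\<Sum>n<N. c n)" for N
    by (simp add: sums_iff)
  moreover have "(\<lambda>N. suminf c - (\<Sum>n<N. c n)) \<longlonglongrightarrow> suminf c - suminf c"
    by (intro tendsto_intros summable_LIMSEQ assms)
  ultimately show ?thesis by simp
qed

text \<open>
  Fatou's theorem. Where the radial limit fails to exist, the oscillation of \<open>b\<close> is that of
  \<open>b - S N\<close> for every Taylor polynomial \<open>S N\<close>, hence at most twice its radial maximal function. The maximal
  inequality, applied to the holomorphic function \<open>(b - S N)\<^sup>2\<close>, bounds the measure of the set where this is large by
  the squared \<open>L\<^sup>2\<close> norm of \<open>b - S N\<close>, a tail of the convergent series in Bessel's inequality.
\<close>

lemma bounded_holomorphic_radial_limits: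
  assumes b: "b holomorphic_on unit_disc" and bM: "\<And>z. z \<in> unit_disc \<Longrightarrow> cmod (b z) \<le> M"
  shows "AE \<theta> in circle_measure. \<exists>l. ((\<lambda>r. b (complex_of_real r * cis \<theta>)) \<longlongrightarrow> l) (at_left 1)"
proof -
  define a where "a n = (deriv ^^ n) b 0 / fact n" for n
  have sums: "(\<lambda>n. a n * z ^ n) sums b z" if "z \<in> unit_disc" for z
    using holomorphic_power_series[OF b that] by (simp add: a_def)
  have bessel: "(\<Sum>n<N. (cmod (a n))\<^sup>2) \<le> M\<^sup>2" for N
  proof -
    have "(\<Sum>n<N. 2 * pi * ((cmod (a n))\<^sup>2 * s ^ (2 * n))) \<le> 2 * pi * M\<^sup>2" if s: "s \<in> {0<..<1}" for s
    proof -
      have ps: "(\<lambda>n. 2 * pi * ((cmod (a n))\<^sup>2 * s ^ (2 * n))) sums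
          (LINT t|circle_measure. (cmod (b (complex_of_real s * cis t)))\<^sup>2)"
        using s by (intro parseval[OF sums]) auto
      have "(\<Sum>n<N. 2 * pi * ((cmod (a n))\<^sup>2 * s ^ (2 * n))) \<le> (\<Sum>n. 2 * pi * ((cmod (a n))\<^sup>2 * s ^ (2 * n)))"
        using s ps by (intro sum_le_suminf) (auto simp: sums_iff)
      also have "\<dots> = (LINT t|circle_measure. (cmod (b (complex_of_real s * cis t)))\<^sup>2)"
        using ps by (simp add: sums_iff)
      also have "\<dots> \<le> (LINT t|circle_measure. M\<^sup>2)"
      proof (rule integral_mono)
        show "integrable circle_measure (\<lambda>t. (cmod (b (complex_of_real s * cis t)))\<^sup>2)"
          using s by (intro continuous_integrable_circle continuous_intros
              continuous_on_compose2[OF holomorphic_on_imp_continuous_on[OF b]]) (auto simp: norm_mult)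
        show "integrable circle_measure (\<lambda>t. M\<^sup>2)" by (intro continuous_integrable_circle continuous_intros)
        show "(cmod (b (complex_of_real s * cis t)))\<^sup>2 \<le> M\<^sup>2" for t
          using s by (intro power_mono bM radius_cis_in_disc) auto
      qed
      also have "\<dots> = 2 * pi * M\<^sup>2" by (simp add: measure_restrict_space)
      finally show ?thesis .
    qed
    then have "eventually (\<lambda>s. (\<Sum>n<N. 2 * pi * ((cmod (a n))\<^sup>2 * s ^ (2 * n))) \<le> 2 * pi * M\<^sup>2) (at_left 1)"
      by (intro eventually_at_leftI[of 0]) auto
    moreover have "((\<lambda>s. \<Sum>n<N. 2 * pi * ((cmod (a n))\<^sup>2 * s ^ (2 * n))) \<longlongrightarrow>
        (\<Sum>n<N. 2 * pi * ((cmod (a n))\<^sup>2 * 1 ^ (2 * n)))) (at_left 1)"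
      by (intro tendsto_intros)
    ultimately have "(\<Sum>n<N. 2 * pi * ((cmod (a n))\<^sup>2 * 1 ^ (2 * n))) \<le> 2 * pi * M\<^sup>2"
      by (intro tendsto_upperbound) auto
    then show ?thesis by (simp flip: sum_distrib_left)
  qed
  have summ: "summable (\<lambda>n. (cmod (a n))\<^sup>2)"
    using bessel by (intro bounded_imp_summable[where B = "M\<^sup>2"]) (simp_all only: lessThan_Suc_atMost[symmetric] zero_le_power2)
  define S where "S N z = (\<Sum>n<N. a n * z ^ n)" for N z
  define g where "g N z = b z - S N z" for N z
  define a' where "a' N n = (if n < N then 0 else a n)" for N n
  define T where "T N = (\<Sum>n. (cmod (a' N n))\<^sup>2)" for N
  have a'2: "(cmod (a' N n))\<^sup>2 = (if n < N then 0 else (cmod (a n))\<^sup>2)" for N n by (simp add: a'_def)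
  have T0: "T \<longlonglongrightarrow> 0" unfolding T_def a'2 by (rule series_tail_tendsto_0[OF summ])
  have g_hol: "g N holomorphic_on unit_disc" for N
    unfolding g_def S_def by (intro holomorphic_intros b)
  have g_sums: "(\<lambda>n. a' N n * z ^ n) sums g N z" if "z \<in> unit_disc" for N z
  proof -
    have "(\<lambda>n. a n * z ^ n - (if n < N then a n * z ^ n else 0)) sums g N z"
      using sums_diff[OF sums[OF that] sums_If_finite[of "\<lambda>n. n < N" "\<lambda>n. a n * z ^ n"]]
      by (simp add: g_def S_def lessThan_def)
    moreover have "(\<lambda>n. a n * z ^ n - (if n < N then a n * z ^ n else 0)) = (\<lambda>n. a' N n * z ^ n)"
      by (auto simp: a'_def)
    ultimately show ?thesis by simp
  qed
  have g_norm: "(LINT t|circle_measure. cmod ((g N (complex_of_real s * cis t))\<^sup>2)) \<le> 2 * pi * T N"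
    if s: "0 \<le> s" "s < 1" for N s
  proof -
    have summ': "summable (\<lambda>n. (cmod (a' N n))\<^sup>2)"
      by (rule summable_comparison_test'[OF summ, of 0]) (simp add: a'2)
    have ps: "(\<lambda>n. 2 * pi * ((cmod (a' N n))\<^sup>2 * s ^ (2 * n))) sums
        (LINT t|circle_measure. (cmod (g N (complex_of_real s * cis t)))\<^sup>2)"
      by (rule parseval[OF g_sums s])
    have "(\<Sum>n. 2 * pi * ((cmod (a' N n))\<^sup>2 * s ^ (2 * n))) \<le> (\<Sum>n. 2 * pi * (cmod (a' N n))\<^sup>2)"
      using s ps summ' by (intro suminf_le) (auto simp: sums_iff mult_left_le power_le_one intro!: summable_mult)
    also have "\<dots> = 2 * pi * T N" unfolding T_def by (rule suminf_mult[OF summ'])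
    finally show ?thesis using ps by (simp add: sums_iff norm_power)
  qed
  define E where "E N \<eta> = {0..2*pi} \<inter> {\<theta>. \<exists>r\<in>{0..<1}. \<eta> < cmod ((g N (complex_of_real r * cis \<theta>))\<^sup>2)}" for N \<eta>
  have Eb: "E N \<eta> \<in> sets lborel" for N \<eta>
  proof -
    have "continuous_on unit_disc (\<lambda>z. (g N z)\<^sup>2)"
      by (intro continuous_intros holomorphic_on_imp_continuous_on g_hol)
    from open_radial_exceeds[OF this, of \<eta>] show ?thesis
      unfolding E_def by (intro sets.Int) (auto intro: borel_open)
  qed
  have E_le: "ennreal \<eta> * emeasure lborel (E N \<eta>) \<le> ennreal (15 * (2 * pi * T N))" if "0 < \<eta>" for N \<eta>
    unfolding E_def using g_norm
    by (intro maximal_weak_type[of "\<lambda>z. (g N z)\<^sup>2", OF _ that]) (auto intro!: holomorphic_intros g_hol)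
  have null: "(\<Inter>N. E N \<eta>) \<in> null_sets lborel" if \<eta>: "0 < \<eta>" for \<eta>
  proof -
    have le: "ennreal \<eta> * emeasure lborel (\<Inter>N. E N \<eta>) \<le> ennreal (15 * (2 * pi * T N))" for N
    proof -
      have "ennreal \<eta> * emeasure lborel (\<Inter>N. E N \<eta>) \<le> ennreal \<eta> * emeasure lborel (E N \<eta>)"
        using Eb by (intro mult_left_mono emeasure_mono) auto
      also note E_le[OF \<eta>]
      finally show ?thesis .
    qed
    have "(\<lambda>N. ennreal (15 * (2 * pi * T N))) \<longlonglongrightarrow> ennreal (15 * (2 * pi * 0))"
      by (intro tendsto_intros T0)
    then have "ennreal \<eta> * emeasure lborel (\<Inter>N. E N \<eta>) \<le> ennreal (15 * (2 * pi * 0))"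
      by (rule LIMSEQ_le_const) (use le in blast)
    then show ?thesis using \<eta> Eb by (auto simp: null_sets_def ennreal_eq_0_iff)
  qed
  have "AE \<theta> in circle_measure. \<forall>m::nat. \<theta> \<notin> (\<Inter>N. E N (1 / real (Suc m)))"
  proof (subst AE_all_countable, rule allI)
    fix m :: nat
    have "AE \<theta> in lborel. \<theta> \<notin> (\<Inter>N. E N (1 / real (Suc m)))"
      by (intro AE_not_in null) simp
    then have "AE \<theta> in lebesgue. \<theta> \<notin> (\<Inter>N. E N (1 / real (Suc m)))"
      by (rule AE_completion)
    then show "AE \<theta> in circle_measure. \<theta> \<notin> (\<Inter>N. E N (1 / real (Suc m)))"
      by (subst AE_restrict_space_iff) auto
  qed
  moreover have "AE \<theta> in circle_measure. \<theta> \<in> {0..2*pi}"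
    by (rule AE_I2) simp
  ultimately show ?thesis
  proof eventually_elim
    case (elim \<theta>)
    show ?case
    proof (rule filter_limit_if_cauchy)
      fix e :: real assume e: "0 < e"
      obtain m :: nat where m: "1 / real (Suc m) < (e / 3)\<^sup>2"
        using nat_approx_posE[of "(e / 3)\<^sup>2"] e by auto
      obtain N where N: "\<theta> \<notin> E N (1 / real (Suc m))" using elim by auto
      have small: "cmod (g N (complex_of_real r * cis \<theta>)) \<le> e / 3" if "r \<in> {0..<1}" for r
      proof -
        have "(cmod (g N (complex_of_real r * cis \<theta>)))\<^sup>2 \<le> (e / 3)\<^sup>2"
          using N elim(2) that m by (force simp: E_def norm_power not_less)
        then show ?thesis using e by (simp add: power2_le_iff_abs_le)
      qed
      have "((\<lambda>r. S N (complex_of_real r * cis \<theta>)) \<longlongrightarrow> S N (complex_of_real 1 * cis \<theta>)) (at_left 1)"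
        unfolding S_def by (intro tendsto_intros)
      then have ev: "eventually (\<lambda>r. dist (S N (complex_of_real r * cis \<theta>)) (S N (complex_of_real 1 * cis \<theta>)) < e / 6) (at_left 1)"
        using e by (intro tendstoD) auto
      have "dist (b (complex_of_real x * cis \<theta>)) (b (complex_of_real y * cis \<theta>)) < e"
        if "x \<in> {0<..<1}" "y \<in> {0<..<1}"
          "dist (S N (complex_of_real x * cis \<theta>)) (S N (complex_of_real 1 * cis \<theta>)) < e / 6"
          "dist (S N (complex_of_real y * cis \<theta>)) (S N (complex_of_real 1 * cis \<theta>)) < e / 6" for x y
      proof -
        have "dist (S N (complex_of_real x * cis \<theta>)) (S N (complex_of_real y * cis \<theta>)) < e / 3"
          using dist_triangle2[of "S N (complex_of_real x * cis \<theta>)" "S N (complex_of_real y * cis \<theta>)" "S N (complex_of_real 1 * cis \<theta>)"]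
            that(3,4) by linarith
        moreover have "cmod (g N (complex_of_real x * cis \<theta>)) \<le> e / 3" "cmod (g N (complex_of_real y * cis \<theta>)) \<le> e / 3"
          using small[of x] small[of y] that(1,2) by auto
        moreover have "b (complex_of_real x * cis \<theta>) - b (complex_of_real y * cis \<theta>)
            = (g N (complex_of_real x * cis \<theta>) - g N (complex_of_real y * cis \<theta>))
            + (S N (complex_of_real x * cis \<theta>) - S N (complex_of_real y * cis \<theta>))"
          by (simp add: g_def)
        ultimately have "dist (b (complex_of_real x * cis \<theta>)) (b (complex_of_real y * cis \<theta>))
            = cmod ((g N (complex_of_real x * cis \<theta>) - g N (complex_of_real y * cis \<theta>))
            + (S N (complex_of_real x * cis \<theta>) - S N (complex_of_real y * cis \<theta>)))"
          and "dist (S N (complex_of_real x * cis \<theta>)) (S N (complex_of_real y * cis \<theta>)) < e / 3"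
          and "cmod (g N (complex_of_real x * cis \<theta>)) \<le> e / 3" "cmod (g N (complex_of_real y * cis \<theta>)) \<le> e / 3"
          by (simp_all only: dist_norm)
        then show ?thesis
          using norm_triangle_ineq[of "g N (complex_of_real x * cis \<theta>) - g N (complex_of_real y * cis \<theta>)"
              "S N (complex_of_real x * cis \<theta>) - S N (complex_of_real y * cis \<theta>)"]
            norm_triangle_ineq4[of "g N (complex_of_real x * cis \<theta>)" "g N (complex_of_real y * cis \<theta>)"]
          unfolding dist_norm by linarith
      qed
      moreover have "eventually (\<lambda>r::real. r \<in> {0<..<1}) (at_left 1)"
        by (rule eventually_at_leftI[of 0]) auto
      ultimately show "\<exists>P. eventually P (at_left 1) \<and> (\<forall>x y. P x \<and> P y \<longrightarrow>
          dist (b (complex_of_real x * cis \<theta>)) (b (complex_of_real y * cis \<theta>)) < e)"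
        using eventually_conj[OF _ ev]
        by (intro exI[of _ "\<lambda>r. r \<in> {0<..<1} \<and>
            dist (S N (complex_of_real r * cis \<theta>)) (S N (complex_of_real 1 * cis \<theta>)) < e / 6"]) blast
    qed simp
  qed
qed

section \<open>Outer functions from Lebesgue means\<close>

text \<open>
  Lebesgue measure is complete. This is needed because \<open>radial_boundary\<close> is an unspecified value
  wherever the radial limit does not exist.
\<close>

lemma circle_measurable_AE:
  fixes f g :: "real \<Rightarrow> real"
  assumes f: "f \<in> borel_measurable circle_measure" and ae: "AE t in circle_measure. f t = g t"
  shows "g \<in> borel_measurable circle_measure"
proof -
  let ?ext = "\<lambda>f t. if t \<in> {0..2*pi} then f t else (0 :: real)"
  have "AE t in lebesgue. t \<in> {0..2*pi} \<longrightarrow> f t = g t"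
    using ae by (subst (asm) AE_restrict_space_iff) auto
  then have "AE t in lebesgue. ?ext f t = ?ext g t"
    by eventually_elim auto
  moreover have "?ext f \<in> borel_measurable lebesgue"
    using f by (subst borel_measurable_if) auto
  ultimately have "?ext g \<in> borel_measurable lebesgue"
    by (intro borel_measurable_AE[of "?ext f" "?ext g"])
  then show ?thesis by (subst (asm) borel_measurable_if) auto
qed

lemma excess_le_powr:
  fixes x m p :: real
  assumes "0 \<le> x" "0 < m" "1 < p"
  shows "x - min x m \<le> x powr p / m powr (p - 1)"
proof (cases "x \<le> m")
  case False
  have "m powr (p - 1) \<le> x powr (p - 1)" using False assms by (intro powr_mono2) auto
  then have "x * m powr (p - 1) \<le> x * x powr (p - 1)" using assms by (intro mult_left_mono)
  also have "x * x powr (p - 1) = x powr p" using False assms by (simp add: powr_diff)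
  finally have "x \<le> x powr p / m powr (p - 1)" using assms by (simp add: le_divide_eq)
  with False assms show ?thesis by auto
qed (use assms in auto)

text \<open>
  Vitali's convergence theorem in the case where an \<open>L\<^sup>p\<close> bound with \<open>p > 1\<close> gives uniform
  integrability: truncate at height \<open>m\<close>, where dominated convergence applies, and bound the excess
  over \<open>m\<close> by \<open>C / m powr (p - 1)\<close>.
\<close>

lemma (in finite_measure) L1_convergence_of_Lp_bound:
  fixes u :: "nat \<Rightarrow> 'a \<Rightarrow> real"
  assumes p: "1 < p" and C: "0 \<le> C"
    and um[measurable]: "\<And>n. u n \<in> borel_measurable M" and u0: "\<And>n x. 0 \<le> u n x"
    and le: "\<And>n. (\<integral>\<^sup>+x. ennreal (u n x powr p) \<partial>M) \<le> ennreal C"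
    and vm[measurable]: "v \<in> borel_measurable M"
    and lim: "AE x in M. (\<lambda>n. u n x) \<longlonglongrightarrow> v x"
  shows "integrable M (\<lambda>x. \<bar>v x\<bar> powr p)" "integrable M v" "\<And>n. integrable M (u n)"
    "(\<lambda>n. LINT x|M. \<bar>u n x - v x\<bar>) \<longlonglongrightarrow> 0"
proof -
  have v0: "AE x in M. 0 \<le> v x"
    using lim by eventually_elim (rule LIMSEQ_le_const, use u0 in auto)
  have "(\<integral>\<^sup>+x. ennreal (\<bar>v x\<bar> powr p) \<partial>M) = (\<integral>\<^sup>+x. liminf (\<lambda>n. ennreal (u n x powr p)) \<partial>M)"
  proof (rule nn_integral_cong_AE, use lim v0 in eventually_elim)
    case (elim x)
    have "(\<lambda>n. u n x powr p) \<longlonglongrightarrow> v x powr p"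
      using elim p u0 by (intro tendsto_powr') auto
    then have "(\<lambda>n. ennreal (u n x powr p)) \<longlonglongrightarrow> ennreal (\<bar>v x\<bar> powr p)"
      using elim by (intro tendsto_ennrealI) auto
    then show ?case by (intro lim_imp_Liminf[symmetric]) auto
  qed
  also have "\<dots> \<le> liminf (\<lambda>n. \<integral>\<^sup>+x. ennreal (u n x powr p) \<partial>M)"
    by (rule nn_integral_liminf) measurable
  also have "\<dots> \<le> ennreal C"
    using le by (intro Liminf_le always_eventually) auto
  finally have vC: "(\<integral>\<^sup>+x. ennreal (\<bar>v x\<bar> powr p) \<partial>M) \<le> ennreal C" .
  show ivp: "integrable M (\<lambda>x. \<bar>v x\<bar> powr p)"
    using vC by (intro integrableI_bounded) (auto simp: le_less_trans)
  have le1: "\<bar>x\<bar> \<le> 1 + \<bar>x\<bar> powr p" for x :: real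
  proof (cases "\<bar>x\<bar> \<le> 1")
    case False
    then have "\<bar>x\<bar> powr 1 \<le> \<bar>x\<bar> powr p" using p by (intro powr_mono) auto
    then show ?thesis by simp
  qed (simp add: add_increasing2)
  have iup: "integrable M (\<lambda>x. u n x powr p)" for n
    using le[of n] by (intro integrableI_bounded) (auto simp: le_less_trans)
  show iv: "integrable M v"
  proof (rule Bochner_Integration.integrable_bound)
    show "integrable M (\<lambda>x. 1 + \<bar>v x\<bar> powr p)" using ivp by simp
  qed (use le1 in auto)
  show iu: "integrable M (u n)" for n
  proof (rule Bochner_Integration.integrable_bound)
    show "integrable M (\<lambda>x. 1 + u n x powr p)" using iup by simp
    show "AE x in M. norm (u n x) \<le> norm (1 + u n x powr p)"
      using le1[of "u n _"] u0 by auto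
  qed simp
  have Cu: "(LINT x|M. u n x powr p) \<le> C" for n
    using le[of n] C by (intro integral_real_bounded) auto
  have Cv: "(LINT x|M. \<bar>v x\<bar> powr p) \<le> C"
    using vC C by (intro integral_real_bounded) auto
  show "(\<lambda>n. LINT x|M. \<bar>u n x - v x\<bar>) \<longlonglongrightarrow> 0"
  proof (rule LIMSEQ_I)
    fix e :: real assume e: "0 < e"
    \<comment> \<open>chosen so that the two excess terms together stay below \<open>e / 2\<close>\<close>
    define m where "m = (4 * C / e + 1) powr (1 / (p - 1))"
    have m: "0 < m" "m powr (p - 1) = 4 * C / e + 1"
    proof -
      have "0 < 4 * C / e + 1" using C e by (intro add_nonneg_pos) auto
      then show "0 < m" "m powr (p - 1) = 4 * C / e + 1" using p by (simp_all add: m_def powr_powr)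
    qed
    let ?D = "\<lambda>n x. \<bar>min (u n x) m - min (v x) m\<bar>"
    have D: "(\<lambda>n. LINT x|M. ?D n x) \<longlonglongrightarrow> (LINT x|M. 0)"
    proof (rule integral_dominated_convergence[where w = "\<lambda>_. m"])
      show "AE x in M. (\<lambda>n. ?D n x) \<longlonglongrightarrow> 0"
        using lim
      proof eventually_elim
        case (elim x)
        then have "(\<lambda>n. ?D n x) \<longlonglongrightarrow> \<bar>min (v x) m - min (v x) m\<bar>" by (intro tendsto_intros)
        then show ?case by simp
      qed
      show "AE x in M. norm (?D n x) \<le> m" for n
        using v0
      proof eventually_elim
        case (elim x)
        then show ?case using u0[of n x] m(1) by (auto simp: min_def abs_if)
      qed
    qed auto
    then have ev: "eventually (\<lambda>n. (LINT x|M. ?D n x) < e / 2) sequentially"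
      using e by (intro order_tendstoD) auto
    have iD: "integrable M (?D n)" for n
      using iu[of n] iv by (intro integrable_abs Bochner_Integration.integrable_diff integrable_min) auto
    have bound: "(LINT x|M. \<bar>u n x - v x\<bar>) < e" if "(LINT x|M. ?D n x) < e / 2" for n
    proof -
      have "(LINT x|M. \<bar>u n x - v x\<bar>) \<le> (LINT x|M. ?D n x + u n x powr p / m powr (p - 1) + \<bar>v x\<bar> powr p / m powr (p - 1))"
      proof (rule integral_mono_AE)
        show "AE x in M. \<bar>u n x - v x\<bar> \<le> ?D n x + u n x powr p / m powr (p - 1) + \<bar>v x\<bar> powr p / m powr (p - 1)"
          using v0
        proof eventually_elim
          case (elim x)
          show ?case
            using excess_le_powr[OF u0 m(1) p, of n x] excess_le_powr[OF elim m(1) p]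
              min.cobounded1[of "u n x" m] min.cobounded1[of "v x" m]
            unfolding abs_of_nonneg[OF elim] by linarith
        qed
      qed (use iD iup ivp iu iv in auto)
      also have "\<dots> = (LINT x|M. ?D n x) + (LINT x|M. u n x powr p) / m powr (p - 1) + (LINT x|M. \<bar>v x\<bar> powr p) / m powr (p - 1)"
        using iD iup ivp by simp
      also have "\<dots> \<le> (LINT x|M. ?D n x) + C / m powr (p - 1) + C / m powr (p - 1)"
        using Cu Cv by (intro add_mono divide_right_mono) auto
      also have "C / m powr (p - 1) < e / 4"
      proof -
        have "C / (4 * C / e + 1) < e / 4" using C e by (simp add: divide_less_eq field_simps add_nonneg_pos)
        then show ?thesis by (simp add: m(2))
      qed
      finally show ?thesis using that by simp
    qed
    obtain N where "\<And>n. N \<le> n \<Longrightarrow> (LINT x|M. ?D n x) < e / 2"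
      using ev by (auto simp: eventually_sequentially)
    then show "\<exists>N. \<forall>n\<ge>N. norm ((LINT x|M. \<bar>u n x - v x\<bar>) - 0) < e"
      using bound by (intro exI[of _ N]) auto
  qed
qed

lemma norm_schwarz_integral_diff_le:
  assumes z: "z \<in> unit_disc" and u: "integrable circle_measure u" and v: "integrable circle_measure v"
  shows "cmod (schwarz_integral u z - schwarz_integral v z) \<le> 2 / (1 - cmod z) * (LINT t|circle_measure. \<bar>u t - v t\<bar>)"
proof -
  let ?k = "schwarz_kernel z"
  have d: "integrable circle_measure (\<lambda>t. u t - v t)" using u v by simp
  have "schwarz_integral u z - schwarz_integral v z
      = 1 / (2 * complex_of_real pi) * (LINT t|circle_measure. ?k t * complex_of_real (u t - v t))"
    using integrable_schwarz_kernel_mult[OF z u] integrable_schwarz_kernel_mult[OF z v]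
    by (simp add: schwarz_integral_def right_diff_distrib)
  then have "cmod (schwarz_integral u z - schwarz_integral v z)
      = 1 / (2 * pi) * cmod (LINT t|circle_measure. ?k t * complex_of_real (u t - v t))"
    by (simp add: norm_mult norm_divide)
  also have "\<dots> \<le> 1 * cmod (LINT t|circle_measure. ?k t * complex_of_real (u t - v t))"
    using pi_gt3 by (intro mult_right_mono) auto
  also have "\<dots> \<le> (LINT t|circle_measure. cmod (?k t * complex_of_real (u t - v t)))"
    by (simp add: integral_norm_bound)
  also have "\<dots> \<le> (LINT t|circle_measure. 2 / (1 - cmod z) * \<bar>u t - v t\<bar>)"
  proof (rule integral_mono)
    show "integrable circle_measure (\<lambda>t. cmod (?k t * complex_of_real (u t - v t)))"
      using integrable_schwarz_kernel_mult[OF z d] by (rule integrable_norm)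
    show "integrable circle_measure (\<lambda>t. 2 / (1 - cmod z) * \<bar>u t - v t\<bar>)" using d by simp
    show "cmod (?k t * complex_of_real (u t - v t)) \<le> 2 / (1 - cmod z) * \<bar>u t - v t\<bar>" for t
      unfolding norm_mult norm_of_real by (intro mult_right_mono norm_schwarz_kernel_le z) auto
  qed
  finally show ?thesis by simp
qed

text \<open>
  With \<open>u n\<close> the values of \<open>Re G\<close> on circles of radius \<open>s n\<close> tending to 1, the Schwarz formula represents
  \<open>G (s n * z)\<close> by \<open>u n\<close>. The radial limits of the bounded function \<open>exp (- G)\<close> make \<open>u n\<close> converge almost
  everywhere, hence in \<open>L\<^sup>1\<close>, and the formula passes to the limit.
\<close>

lemma exp_outer_function:
  assumes p: "1 < p" and C: "0 \<le> C" and G: "G holomorphic_on unit_disc"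
    and G0: "\<And>z. z \<in> unit_disc \<Longrightarrow> 0 \<le> Re (G z)"
    and le: "\<And>r. 0 < r \<Longrightarrow> r < 1 \<Longrightarrow>
      (\<integral>\<^sup>+t. ennreal (Re (G (complex_of_real r * cis t)) powr p) \<partial>circle_measure) \<le> ennreal C"
  shows "outer_function (\<lambda>z. exp (G z))"
    and "in_Lp p circle_measure (\<lambda>t. ln (cmod (radial_boundary (\<lambda>z. exp (G z)) t)))"
proof -
  interpret finite_measure circle_measure by (rule finite_measure_circle)
  define F where "F z = exp (G z)" for z
  define b where "b z = exp (- G z)" for z
  define s :: "nat \<Rightarrow> real" where "s n = 1 - 1 / real (Suc (Suc n))" for n
  define u where "u n t = Re (G (complex_of_real (s n) * cis t))" for n t
  define v where "v t = ln (cmod (radial_boundary F t))" for t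
  have s: "0 < s n" "s n < 1" for n by (auto simp: s_def field_simps)
  have s1: "filterlim s (at_left 1) sequentially"
  proof -
    have "s \<longlonglongrightarrow> 1"
      using LIMSEQ_Suc[OF LIMSEQ_inverse_real_of_nat_add_minus[of 1]]
      unfolding s_def[abs_def] by (simp only: diff_conv_add_uminus inverse_eq_divide)
    then show ?thesis
      using s less_imp_neq[OF s(2)] by (simp add: filterlim_at)
  qed
  have sz: "complex_of_real (s n) * z \<in> unit_disc" if "z \<in> cball 0 1" for n z
    using s[of n] that by (intro dilation_in_disc) auto
  have Gs: "(\<lambda>w. G (complex_of_real (s n) * w)) holomorphic_on cball 0 1" for n
    using s[of n] by (intro holomorphic_dilation[OF G]) auto
  have um: "u n \<in> borel_measurable circle_measure" for n
    unfolding u_def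
    by (intro continuous_imp_measurable_on_sets_lebesgue continuous_intros
        continuous_on_compose2[OF holomorphic_on_imp_continuous_on[OF Gs]]) auto
  have u0: "0 \<le> u n t" for n t unfolding u_def by (intro G0 sz) auto
  have uC: "(\<integral>\<^sup>+t. ennreal (u n t powr p) \<partial>circle_measure) \<le> ennreal C" for n
    unfolding u_def by (rule le[OF s])
  have lim_b: "AE t in circle_measure. \<exists>l. ((\<lambda>r. b (complex_of_real r * cis t)) \<longlongrightarrow> l) (at_left 1)"
    unfolding b_def using G G0
    by (intro bounded_holomorphic_radial_limits[where M = 1] holomorphic_intros) auto
  have fin: "AE t in circle_measure. liminf (\<lambda>n. ennreal (u n t powr p)) \<noteq> \<infinity>"
  proof (rule nn_integral_noteq_infinite)
    show "(\<lambda>t. liminf (\<lambda>n. ennreal (u n t powr p))) \<in> borel_measurable circle_measure"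
      using um by measurable
    have "(\<integral>\<^sup>+t. liminf (\<lambda>n. ennreal (u n t powr p)) \<partial>circle_measure)
        \<le> liminf (\<lambda>n. \<integral>\<^sup>+t. ennreal (u n t powr p) \<partial>circle_measure)"
      using um by (intro nn_integral_liminf) measurable
    also have "\<dots> \<le> ennreal C"
      using uC by (intro Liminf_le always_eventually) auto
    finally show "(\<integral>\<^sup>+t. liminf (\<lambda>n. ennreal (u n t powr p)) \<partial>circle_measure) \<noteq> \<infinity>"
      by (auto simp: top_unique)
  qed
  have lim_F: "AE t in circle_measure. \<exists>l. l \<noteq> 0 \<and> ((\<lambda>r. F (complex_of_real r * cis t)) \<longlongrightarrow> l) (at_left 1)"
    using lim_b fin
  proof eventually_elim
    case (elim t)
    then obtain l where l: "((\<lambda>r. b (complex_of_real r * cis t)) \<longlongrightarrow> l) (at_left 1)" by blast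
    \<comment> \<open>if \<open>l = 0\<close> then \<open>Re G\<close> tends to infinity along the radius, against the finite lower limit\<close>
    have "l \<noteq> 0"
    proof
      assume l0: "l = 0"
      obtain q where q: "0 \<le> q" "liminf (\<lambda>n. ennreal (u n t powr p)) = ennreal q"
        using elim(2) by (cases "liminf (\<lambda>n. ennreal (u n t powr p))") auto
      \<comment> \<open>so that \<open>K powr p = q + 1\<close> exceeds the lower limit \<open>q\<close>\<close>
      define K where "K = (q + 1) powr (1 / p)"
      have K: "0 \<le> K" "K powr p = q + 1" using q p by (auto simp: K_def powr_powr)
      have "((\<lambda>n. cmod (b (complex_of_real (s n) * cis t))) \<longlonglongrightarrow> cmod l)"
        by (intro tendsto_intros filterlim_compose[OF l s1])
      then have "eventually (\<lambda>n. cmod (b (complex_of_real (s n) * cis t)) < exp (- K)) sequentially"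
        using l0 by (intro order_tendstoD) auto
      then have "eventually (\<lambda>n. ennreal (q + 1) \<le> ennreal (u n t powr p)) sequentially"
      proof eventually_elim
        case (elim n)
        then have "K \<le> u n t" by (simp add: b_def u_def)
        then show ?case using K p by (intro ennreal_leI) (metis powr_mono2 less_imp_le less_trans zero_less_one)
      qed
      then have "ennreal (q + 1) \<le> ennreal q"
        unfolding q(2)[symmetric] by (rule Liminf_bounded)
      with q(1) show False by simp
    qed
    moreover have "((\<lambda>r. F (complex_of_real r * cis t)) \<longlongrightarrow> inverse l) (at_left 1)"
      using tendsto_inverse[OF l \<open>l \<noteq> 0\<close>] by (simp add: F_def b_def exp_minus)
    ultimately show ?case by (intro exI[of _ "inverse l"]) auto
  qed
  have lim_u: "AE t in circle_measure. (\<lambda>n. u n t) \<longlonglongrightarrow> v t"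
    using lim_F
  proof eventually_elim
    case (elim t)
    then obtain l where l: "l \<noteq> 0" "((\<lambda>r. F (complex_of_real r * cis t)) \<longlongrightarrow> l) (at_left 1)" by blast
    then have "radial_boundary F t = l" unfolding radial_boundary_def by (intro tendsto_Lim) auto
    moreover have "(\<lambda>n. ln (cmod (F (complex_of_real (s n) * cis t)))) \<longlonglongrightarrow> ln (cmod l)"
      using l(1) by (intro tendsto_intros filterlim_compose[OF l(2) s1]) auto
    ultimately show ?case by (simp add: F_def u_def v_def)
  qed
  have vm: "v \<in> borel_measurable circle_measure"
  proof (rule circle_measurable_AE)
    show "(\<lambda>t. lim (\<lambda>n. u n t)) \<in> borel_measurable circle_measure"
      using um by (rule borel_measurable_lim_metric)
    show "AE t in circle_measure. lim (\<lambda>n. u n t) = v t"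
      using lim_u by eventually_elim (rule limI)
  qed
  note conv = L1_convergence_of_Lp_bound[OF p C um u0 uC vm lim_u]
  show "in_Lp p circle_measure (\<lambda>t. ln (cmod (radial_boundary (\<lambda>z. exp (G z)) t)))"
    using conv(1) vm by (simp add: in_Lp_def v_def[abs_def] F_def[abs_def])
  have rep: "G z = schwarz_integral v z + \<i> * complex_of_real (Im (G 0))" if z: "z \<in> unit_disc" for z
  proof -
    have "\<forall>n. norm (schwarz_integral (u n) z - schwarz_integral v z)
        \<le> 2 / (1 - cmod z) * (LINT t|circle_measure. \<bar>u n t - v t\<bar>)"
      using norm_schwarz_integral_diff_le[OF z conv(3) conv(2)] by blast
    from Lim_null_comparison[OF always_eventually[OF this] tendsto_mult_right_zero[OF conv(4)]]
    have "(\<lambda>n. schwarz_integral (u n) z - schwarz_integral v z) \<longlonglongrightarrow> 0" .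
    then have "(\<lambda>n. schwarz_integral (u n) z + \<i> * complex_of_real (Im (G 0))) \<longlonglongrightarrow>
        schwarz_integral v z + \<i> * complex_of_real (Im (G 0))"
      by (intro tendsto_intros) (rule LIM_zero_cancel)
    moreover have "schwarz_integral (u n) z + \<i> * complex_of_real (Im (G 0)) = G (complex_of_real (s n) * z)" for n
      using schwarz_formula[OF Gs[of n] z] by (simp add: u_def[abs_def])
    ultimately have "(\<lambda>n. G (complex_of_real (s n) * z)) \<longlonglongrightarrow> schwarz_integral v z + \<i> * complex_of_real (Im (G 0))"
      by simp
    moreover have "isCont G z"
      using G z holomorphic_on_imp_continuous_on continuous_on_interior[of unit_disc G z]
      by (simp add: interior_open)
    then have "(\<lambda>n. G (complex_of_real (s n) * z)) \<longlonglongrightarrow> G z"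
    proof (rule isCont_tendsto_compose)
      have "s \<longlonglongrightarrow> 1" using s1 by (simp add: filterlim_at)
      then have "(\<lambda>n. complex_of_real (s n) * z) \<longlonglongrightarrow> complex_of_real 1 * z"
        by (intro tendsto_intros)
      then show "(\<lambda>n. complex_of_real (s n) * z) \<longlonglongrightarrow> z" by simp
    qed
    ultimately show ?thesis by (rule LIMSEQ_unique[rotated])
  qed
  have L1: "in_Lp 1 circle_measure v"
    using conv(2) vm by (simp add: in_Lp_def)
  \<comment> \<open>the unimodular constant comes from \<open>Im (G 0)\<close>, which the Schwarz integral does not see\<close>
  have "\<exists>c. cmod c = 1 \<and> (\<forall>z\<in>unit_disc. F z = c * exp (schwarz_integral v z))"
  proof (intro exI[of _ "exp (\<i> * complex_of_real (Im (G 0)))"] conjI ballI)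
    fix z :: complex assume "z \<in> unit_disc"
    from rep[OF this] show "F z = exp (\<i> * complex_of_real (Im (G 0))) * exp (schwarz_integral v z)"
      by (simp only: F_def exp_add mult.commute)
  qed simp
  moreover have "F holomorphic_on unit_disc" unfolding F_def using G by (intro holomorphic_intros)
  ultimately have "outer_function F"
    using lim_F L1 unfolding outer_function_def v_def[abs_def] schwarz_integral_def schwarz_kernel_def
    by (intro conjI)
  then show "outer_function (\<lambda>z. exp (G z))" by (simp add: F_def[abs_def])
qed

section \<open>Outer majorants of functions with bounded logarithmic means\<close>

text \<open>
  Real parts in the class \<open>h\<^sup>p\<close>. The outer functions needed for the theorem are kept in the form \<open>exp G\<close>
  because sums of such \<open>G\<close> stay in this class by an elementary estimate, which makes products of these
  outer functions outer without comparing boundary values.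
\<close>

definition Lp_positive :: "real \<Rightarrow> (complex \<Rightarrow> complex) \<Rightarrow> bool"
  where "Lp_positive p G \<longleftrightarrow> G holomorphic_on unit_disc \<and> (\<forall>z\<in>unit_disc. 0 \<le> Re (G z)) \<and>
    (\<exists>C\<ge>0. \<forall>r\<in>{0<..<1}.
      (\<integral>\<^sup>+t. ennreal (Re (G (complex_of_real r * cis t)) powr p) \<partial>circle_measure) \<le> ennreal C)"

lemma Lp_positive_outer:
  assumes "1 < p" "Lp_positive p G"
  shows "outer_function (\<lambda>z. exp (G z))"
    and "in_Lp p circle_measure (\<lambda>t. ln (cmod (radial_boundary (\<lambda>z. exp (G z)) t)))"
proof -
  from assms(2) obtain C where "0 \<le> C" "G holomorphic_on unit_disc"
    "\<And>z. z \<in> unit_disc \<Longrightarrow> 0 \<le> Re (G z)"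
    "\<And>r. 0 < r \<Longrightarrow> r < 1 \<Longrightarrow>
      (\<integral>\<^sup>+t. ennreal (Re (G (complex_of_real r * cis t)) powr p) \<partial>circle_measure) \<le> ennreal C"
    unfolding Lp_positive_def by auto
  from exp_outer_function[OF assms(1) this]
  show "outer_function (\<lambda>z. exp (G z))"
    and "in_Lp p circle_measure (\<lambda>t. ln (cmod (radial_boundary (\<lambda>z. exp (G z)) t)))" by auto
qed

lemma Lp_positive_0: "Lp_positive p (\<lambda>_. 0)"
  by (auto simp: Lp_positive_def intro!: exI[of _ 0])

lemma Lp_positive_add:
  assumes p: "1 < p" and G: "Lp_positive p G" and H: "Lp_positive p H"
  shows "Lp_positive p (\<lambda>z. G z + H z)"
proof -
  obtain A where A: "0 \<le> A" "\<And>r. r \<in> {0<..<1} \<Longrightarrow>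
      (\<integral>\<^sup>+t. ennreal (Re (G (complex_of_real r * cis t)) powr p) \<partial>circle_measure) \<le> ennreal A"
    using G unfolding Lp_positive_def by auto
  obtain B where B: "0 \<le> B" "\<And>r. r \<in> {0<..<1} \<Longrightarrow>
      (\<integral>\<^sup>+t. ennreal (Re (H (complex_of_real r * cis t)) powr p) \<partial>circle_measure) \<le> ennreal B"
    using H unfolding Lp_positive_def by auto
  have hol: "G holomorphic_on unit_disc" "H holomorphic_on unit_disc"
    and pos: "\<And>z. z \<in> unit_disc \<Longrightarrow> 0 \<le> Re (G z)" "\<And>z. z \<in> unit_disc \<Longrightarrow> 0 \<le> Re (H z)"
    using G H by (auto simp: Lp_positive_def)
  have "(\<integral>\<^sup>+t. ennreal (Re (G (complex_of_real r * cis t) + H (complex_of_real r * cis t)) powr p) \<partial>circle_measure)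
      \<le> ennreal (3 powr p * (2 * pi + A + B))" if r: "r \<in> {0<..<1}" for r
  proof -
    let ?g = "\<lambda>t. Re (G (complex_of_real r * cis t))" and ?h = "\<lambda>t. Re (H (complex_of_real r * cis t))"
    have z: "complex_of_real r * cis t \<in> unit_disc" for t using r by (intro radius_cis_in_disc) auto
    have "?g \<in> borel_measurable circle_measure" "?h \<in> borel_measurable circle_measure"
      using z by (intro continuous_imp_measurable_on_sets_lebesgue continuous_intros
          continuous_on_compose2[OF holomorphic_on_imp_continuous_on[OF hol(1)]]
          continuous_on_compose2[OF holomorphic_on_imp_continuous_on[OF hol(2)]]; auto)+
    note [measurable] = this
    have "(\<integral>\<^sup>+t. ennreal ((?g t + ?h t) powr p) \<partial>circle_measure)
        \<le> (\<integral>\<^sup>+t. ennreal (3 powr p) * (ennreal 1 + ennreal (?g t powr p) + ennreal (?h t powr p)) \<partial>circle_measure)"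
    proof (rule nn_integral_mono)
      fix t
      have "(?g t + ?h t) powr p \<le> 3 powr p * (1 + ?g t powr p + ?h t powr p)"
        using pos[OF z[of t]] p by (intro powr_sum3_le) auto
      then show "ennreal ((?g t + ?h t) powr p) \<le> ennreal (3 powr p) * (ennreal 1 + ennreal (?g t powr p) + ennreal (?h t powr p))"
        by (simp add: ennreal_mult'[symmetric] ennreal_leI flip: ennreal_plus ennreal_1)
    qed
    also have "\<dots> = ennreal (3 powr p) * ((\<integral>\<^sup>+t. ennreal 1 \<partial>circle_measure)
        + (\<integral>\<^sup>+t. ennreal (?g t powr p) \<partial>circle_measure) + (\<integral>\<^sup>+t. ennreal (?h t powr p) \<partial>circle_measure))"
      by (simp add: nn_integral_cmult nn_integral_add del: nn_integral_const)
    also have "\<dots> \<le> ennreal (3 powr p) * (ennreal (2 * pi) + ennreal A + ennreal B)"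
      using A(2)[OF r] B(2)[OF r] by (intro mult_left_mono add_mono) (auto simp: emeasure_restrict_space)
    also have "\<dots> = ennreal (3 powr p * (2 * pi + A + B))"
      using A(1) B(1)
      by (simp only: ennreal_plus[symmetric] ennreal_mult'[symmetric] powr_ge_zero mult_nonneg_nonneg
          pi_ge_zero add_nonneg_nonneg zero_le_numeral)
    finally show ?thesis by simp
  qed
  then show ?thesis
    using A(1) B(1) hol pos unfolding Lp_positive_def
    by (auto intro!: holomorphic_intros exI[of _ "3 powr p * (2 * pi + A + B)"])
qed

text \<open>
  Existence of the harmonic majorant of \<open>log\<^sup>+ \<bar>f\<bar>\<close>. Montel's theorem
  applies to the functions \<open>exp (- H n)\<close>, where \<open>H n\<close> has as real part the Poisson integral of \<open>log\<^sup>+ \<bar>f\<bar>\<close>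
  on the circle of radius \<open>s n\<close>. Their limit has no zero because Jensen's inequality bounds
  \<open>Re (H n z)\<close> independently of \<open>n\<close>.
\<close>

lemma N_ring_majorant:
  assumes p: "1 < p" and f: "f \<in> carrier (N_ring p)"
  obtains G where "Lp_positive p G" "\<And>z. z \<in> unit_disc \<Longrightarrow> cmod (f z) \<le> exp (Re (G z))"
proof -
  have hol: "f holomorphic_on unit_disc" using f by (simp add: N_ring_def disc_fun_ring_def)
  let ?L = "\<lambda>r t. log_plus (cmod (f (complex_of_real r * cis t))) powr p"
  obtain C where C: "0 \<le> C" "\<And>r. r \<in> {0<..<1} \<Longrightarrow> (\<integral>\<^sup>+t. ennreal (?L r t) \<partial>circle_measure) \<le> ennreal C"
  proof -
    define A where "A = (SUP r\<in>{0<..<1}. \<integral>\<^sup>+t. ennreal (?L r t / (2*pi)) \<partial>circle_measure)"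
    have A: "A < \<infinity>" using f by (simp add: N_ring_def disc_fun_ring_def A_def)
    then obtain B where B: "0 \<le> B" "A = ennreal B" by (cases A) auto
    show thesis
    proof (rule that[of "2 * pi * B"])
      fix r :: real assume r: "r \<in> {0<..<1}"
      have [measurable]: "(\<lambda>t. ?L r t / (2*pi)) \<in> borel_measurable circle_measure"
        using r by (intro N_ring_measurable[OF hol]) auto
      have "(\<integral>\<^sup>+t. ennreal (?L r t) \<partial>circle_measure) = (\<integral>\<^sup>+t. ennreal (2*pi) * ennreal (?L r t / (2*pi)) \<partial>circle_measure)"
        by (intro nn_integral_cong) (simp flip: ennreal_mult')
      also have "\<dots> = ennreal (2*pi) * (\<integral>\<^sup>+t. ennreal (?L r t / (2*pi)) \<partial>circle_measure)"
        by (rule nn_integral_cmult) measurable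
      also have "\<dots> \<le> ennreal (2*pi) * A"
        unfolding A_def using r by (intro mult_left_mono SUP_upper) auto
      also have "\<dots> = ennreal (2 * pi * B)" by (simp only: B(2)) (simp add: ennreal_mult')
      finally show "(\<integral>\<^sup>+t. ennreal (?L r t) \<partial>circle_measure) \<le> ennreal (2 * pi * B)" .
    qed (use B in auto)
  qed
  define s :: "nat \<Rightarrow> real" where "s n = 1 - 1 / real (Suc (Suc n))" for n
  have s: "0 < s n" "s n < 1" for n by (auto simp: s_def field_simps)
  have s1: "s \<longlonglongrightarrow> 1"
    using LIMSEQ_Suc[OF LIMSEQ_inverse_real_of_nat_add_minus[of 1]]
    unfolding s_def[abs_def] by (simp only: diff_conv_add_uminus inverse_eq_divide)
  define \<phi> where "\<phi> n w = log_plus (cmod (f (complex_of_real (s n) * w)))" for n w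
  define H where "H n = schwarz_integral (\<lambda>t. \<phi> n (cis t))" for n
  have fs: "(\<lambda>w. f (complex_of_real (s n) * w)) holomorphic_on cball 0 1" for n
    using s[of n] by (intro holomorphic_dilation[OF hol]) auto
  have fsc: "continuous_on (cball 0 1) (\<lambda>w. f (complex_of_real (s n) * w))" for n
    using fs by (rule holomorphic_on_imp_continuous_on)
  have \<phi>c: "continuous_on (sphere 0 1) (\<phi> n)" for n
    unfolding \<phi>_def by (intro continuous_log_plus_cmod continuous_on_subset[OF fsc]) auto
  have \<phi>0: "0 \<le> \<phi> n w" for n w by (simp add: \<phi>_def log_plus_nonneg)
  have \<phi>ct: "continuous_on {0..2*pi} (\<lambda>t. \<phi> n (cis t))" for n
    by (rule continuous_circle_trace[OF \<phi>c])
  have i\<phi>: "integrable circle_measure (\<lambda>t. \<phi> n (cis t))" for n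
    by (rule continuous_integrable_circle[OF \<phi>ct])
  have ip\<phi>: "integrable circle_measure (\<lambda>t. \<phi> n (cis t) powr p)" for n
    using p \<phi>0 by (intro continuous_integrable_circle continuous_on_powr' \<phi>ct continuous_intros) auto
  have \<phi>C: "(\<integral>\<^sup>+t. ennreal (\<phi> n (cis t) powr p) \<partial>circle_measure) \<le> ennreal C" for n
    unfolding \<phi>_def using s by (intro C(2)) auto
  have Hhol: "H n holomorphic_on unit_disc" for n
    unfolding H_def by (rule holomorphic_schwarz_integral[OF \<phi>ct])
  have ReH: "Re (H n z) = poisson_integral (\<lambda>t. \<phi> n (cis t)) z" if "z \<in> unit_disc" for n z
    unfolding H_def using Re_schwarz_integral[OF that i\<phi>] .
  have ReH0: "0 \<le> Re (H n z)" if "z \<in> unit_disc" for n z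
    using poisson_integral_nonneg[OF that] \<phi>0 by (simp add: ReH[OF that])
  have fH: "cmod (f (complex_of_real (s n) * z)) \<le> exp (Re (H n z))" if "z \<in> unit_disc" for n z
    unfolding ReH[OF that]
    by (rule poisson_majorant[OF _ fsc \<phi>c _ that])
      (auto simp: \<phi>_def le_exp_log_plus intro: holomorphic_on_subset[OF fs])
  have Hp: "(\<integral>\<^sup>+t. ennreal (Re (H n (complex_of_real r * cis t)) powr p) \<partial>circle_measure) \<le> ennreal C"
    if r: "r \<in> {0<..<1}" for n r
  proof -
    have z: "complex_of_real r * cis t \<in> unit_disc" for t using r by (intro radius_cis_in_disc) auto
    show ?thesis unfolding ReH[OF z]
      using r by (intro order_trans[OF poisson_integral_Lp \<phi>C] p \<phi>0 i\<phi> ip\<phi>) auto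
  qed
  \<comment> \<open>a bound for \<open>Re (H n z)\<close> that does not depend on \<open>n\<close>\<close>
  define Q where "Q z = (2 / (1 - cmod z) * C) powr (1 / p)" for z :: complex
  have HQ: "Re (H n z) \<le> Q z" if z: "z \<in> unit_disc" for n z
  proof -
    have "Re (H n z) powr p \<le> poisson_integral (\<lambda>t. \<phi> n (cis t) powr p) z"
      unfolding ReH[OF z] by (rule poisson_integral_powr_le[OF z p \<phi>0 i\<phi> ip\<phi>])
    also have "\<dots> \<le> (LINT t|circle_measure. 2 / (1 - cmod z) * \<phi> n (cis t) powr p) / (2 * pi)"
      unfolding poisson_integral_def
    proof (intro divide_right_mono integral_mono)
      show "integrable circle_measure (\<lambda>t. poisson_kernel z t * \<phi> n (cis t) powr p)"
        by (rule integrable_poisson_kernel_mult[OF z ip\<phi>])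
      show "poisson_kernel z t * \<phi> n (cis t) powr p \<le> 2 / (1 - cmod z) * \<phi> n (cis t) powr p" for t
        using abs_poisson_kernel_le[OF z, of t] by (intro mult_right_mono) auto
    qed (use ip\<phi> in auto)
    also have "\<dots> \<le> (LINT t|circle_measure. 2 / (1 - cmod z) * \<phi> n (cis t) powr p) / 1"
      using pi_gt3 z by (intro divide_left_mono integral_nonneg_AE AE_I2) auto
    also have "\<dots> = 2 / (1 - cmod z) * (LINT t|circle_measure. \<phi> n (cis t) powr p)" by simp
    also have "\<dots> \<le> 2 / (1 - cmod z) * C"
      using z C(1) \<phi>C[of n] by (intro mult_left_mono integral_real_bounded) auto
    finally have "(Re (H n z) powr p) powr (1 / p) \<le> Q z"
      unfolding Q_def using p by (intro powr_mono2) auto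
    then show ?thesis using p ReH0[OF z] by (simp add: powr_powr)
  qed
  define B where "B n z = exp (- H n z)" for n z
  have Bn: "cmod (B n z) = exp (- Re (H n z))" for n z by (simp add: B_def)
  obtain b k where b: "b holomorphic_on unit_disc" and k: "strict_mono (k :: nat \<Rightarrow> nat)"
    and lim: "\<And>z. z \<in> unit_disc \<Longrightarrow> (\<lambda>n. B (k n) z) \<longlonglongrightarrow> b z"
  proof (rule Montel[of unit_disc "range B" B])
    show "h holomorphic_on unit_disc" if "h \<in> range B" for h
      using that unfolding B_def by (auto intro!: holomorphic_intros Hhol)
    show "\<exists>A. \<forall>h\<in>range B. \<forall>z\<in>K. cmod (h z) \<le> A" if "compact K" "K \<subseteq> unit_disc" for K
      using that ReH0 by (intro exI[of _ 1]) (auto simp: Bn)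
  qed auto
  have limn: "(\<lambda>n. cmod (B (k n) z)) \<longlonglongrightarrow> cmod (b z)" if "z \<in> unit_disc" for z
    by (intro tendsto_intros lim that)
  have b0: "b z \<noteq> 0" if z: "z \<in> unit_disc" for z
  proof -
    have "exp (- Q z) \<le> cmod (b z)"
      by (rule LIMSEQ_le_const[OF limn[OF z]]) (use HQ[OF z] in \<open>auto simp: Bn\<close>)
    then show ?thesis by (metis exp_gt_zero not_le norm_zero)
  qed
  obtain q where q: "q holomorphic_on unit_disc" "\<And>z. z \<in> unit_disc \<Longrightarrow> b z = exp (q z)"
    using contractible_imp_holomorphic_log[OF b convex_imp_contractible[OF convex_ball] b0] by blast
  define G where "G z = - q z" for z
  have ReG: "(\<lambda>n. Re (H (k n) z)) \<longlonglongrightarrow> Re (G z)" if z: "z \<in> unit_disc" for z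
  proof -
    have "(\<lambda>n. - ln (cmod (B (k n) z))) \<longlonglongrightarrow> - ln (cmod (b z))"
      using b0[OF z] by (intro tendsto_intros limn z) auto
    then show ?thesis using q(2)[OF z] by (simp add: Bn G_def)
  qed
  have G0: "0 \<le> Re (G z)" if "z \<in> unit_disc" for z
    by (rule LIMSEQ_le_const[OF ReG[OF that]]) (use ReH0[OF that] in auto)
  have "Lp_positive p G" unfolding Lp_positive_def
  proof (intro conjI ballI exI[of _ C])
    show "G holomorphic_on unit_disc" unfolding G_def using q(1) by (intro holomorphic_intros)
    fix r :: real assume r: "r \<in> {0<..<1}"
    have z: "complex_of_real r * cis t \<in> unit_disc" for t using r by (intro radius_cis_in_disc) auto
    have Hm: "(\<lambda>t. Re (H n (complex_of_real r * cis t))) \<in> borel_measurable circle_measure" for n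
      using z by (intro continuous_imp_measurable_on_sets_lebesgue continuous_intros
          continuous_on_compose2[OF holomorphic_on_imp_continuous_on[OF Hhol]]) auto
    have "(\<lambda>x::real. ennreal (x powr p)) \<in> borel_measurable borel" by measurable
    note Hpm = measurable_compose[OF Hm this]
    have "(\<integral>\<^sup>+t. ennreal (Re (G (complex_of_real r * cis t)) powr p) \<partial>circle_measure)
        = (\<integral>\<^sup>+t. liminf (\<lambda>n. ennreal (Re (H (k n) (complex_of_real r * cis t)) powr p)) \<partial>circle_measure)"
    proof (rule nn_integral_cong)
      fix t
      have "(\<lambda>n. Re (H (k n) (complex_of_real r * cis t)) powr p) \<longlonglongrightarrow> Re (G (complex_of_real r * cis t)) powr p"
        using p ReH0[OF z] by (intro tendsto_powr' ReG[OF z]) auto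
      then have "(\<lambda>n. ennreal (Re (H (k n) (complex_of_real r * cis t)) powr p)) \<longlonglongrightarrow> ennreal (Re (G (complex_of_real r * cis t)) powr p)"
        by (intro tendsto_ennrealI)
      then show "ennreal (Re (G (complex_of_real r * cis t)) powr p)
          = liminf (\<lambda>n. ennreal (Re (H (k n) (complex_of_real r * cis t)) powr p))"
        by (intro lim_imp_Liminf[symmetric]) auto
    qed
    also have "\<dots> \<le> liminf (\<lambda>n. \<integral>\<^sup>+t. ennreal (Re (H (k n) (complex_of_real r * cis t)) powr p) \<partial>circle_measure)"
      by (intro nn_integral_liminf Hpm)
    also have "\<dots> \<le> ennreal C"
      using Hp[OF r] by (intro Liminf_le always_eventually) auto
    finally show "(\<integral>\<^sup>+t. ennreal (Re (G (complex_of_real r * cis t)) powr p) \<partial>circle_measure) \<le> ennreal C" .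
  qed (use G0 C(1) in auto)
  moreover have "cmod (f z) \<le> exp (Re (G z))" if z: "z \<in> unit_disc" for z
  proof (rule LIMSEQ_le)
    have "isCont f z"
      using hol z holomorphic_on_imp_continuous_on continuous_on_interior[of unit_disc f z]
      by (simp add: interior_open)
    then have "(\<lambda>n. f (complex_of_real (s (k n)) * z)) \<longlonglongrightarrow> f z"
    proof (rule isCont_tendsto_compose)
      have "(\<lambda>n. complex_of_real (s (k n)) * z) \<longlonglongrightarrow> complex_of_real 1 * z"
        using LIMSEQ_subseq_LIMSEQ[OF s1 k] by (intro tendsto_intros) (simp add: o_def)
      then show "(\<lambda>n. complex_of_real (s (k n)) * z) \<longlonglongrightarrow> z" by simp
    qed
    then show "(\<lambda>n. cmod (f (complex_of_real (s (k n)) * z))) \<longlonglongrightarrow> cmod (f z)" by (intro tendsto_intros)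
    show "(\<lambda>n. exp (Re (H (k n) z))) \<longlonglongrightarrow> exp (Re (G z))" by (intro tendsto_intros ReG z)
    show "\<exists>N. \<forall>n\<ge>N. cmod (f (complex_of_real (s (k n)) * z)) \<le> exp (Re (H (k n) z))"
      using fH[OF z] by blast
  qed
  ultimately show thesis by (rule that)
qed

section \<open>Ideals and their traces\<close>

text \<open>
  Negatives come for free, as \<open>- x = (- 1) x\<close>.
\<close>

lemma (in cring) ideal_if_closed:
  assumes sub: "J \<subseteq> carrier R" and ne: "J \<noteq> {}"
    and add: "\<And>x y. x \<in> J \<Longrightarrow> y \<in> J \<Longrightarrow> x \<oplus> y \<in> J"
    and mult: "\<And>a x. a \<in> carrier R \<Longrightarrow> x \<in> J \<Longrightarrow> a \<otimes> x \<in> J"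
  shows "ideal J R"
proof (rule idealI)
  show "ring R" by (rule ring_axioms)
  show "subgroup J (add_monoid R)"
  proof
    obtain x where x: "x \<in> J" using ne by blast
    then have "\<zero> \<otimes> x \<in> J" by (intro mult) auto
    then show "\<one>\<^bsub>add_monoid R\<^esub> \<in> J" using x sub by auto
    fix x assume x: "x \<in> J"
    then have "(\<ominus> \<one>) \<otimes> x \<in> J" by (intro mult) auto
    then show "inv\<^bsub>add_monoid R\<^esub> x \<in> J" using x sub by (auto simp: l_minus a_inv_def[symmetric])
  qed (use sub add in auto)
  show "a \<in> J \<Longrightarrow> x \<in> carrier R \<Longrightarrow> x \<otimes> a \<in> J" for a x using mult by auto
  show "a \<in> J \<Longrightarrow> x \<in> carrier R \<Longrightarrow> a \<otimes> x \<in> J" for a x using mult sub m_comm[of a x] by auto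
qed

lemma mult_H_infinity: "f \<otimes>\<^bsub>H_infinity\<^esub> g = (\<lambda>z\<in>unit_disc. f z * g z)"
  and mult_N_ring: "f \<otimes>\<^bsub>N_ring p\<^esub> g = (\<lambda>z\<in>unit_disc. f z * g z)"
  and add_H_infinity: "f \<oplus>\<^bsub>H_infinity\<^esub> g = (\<lambda>z\<in>unit_disc. f z + g z)"
  and add_N_ring: "f \<oplus>\<^bsub>N_ring p\<^esub> g = (\<lambda>z\<in>unit_disc. f z + g z)"
  by (simp_all add: H_infinity_def N_ring_def disc_fun_ring_def)

lemma in_H_infinityI:
  assumes "f holomorphic_on unit_disc" "\<And>z. z \<in> unit_disc \<Longrightarrow> cmod (f z) \<le> M"
  shows "(\<lambda>z\<in>unit_disc. f z) \<in> carrier H_infinity"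
proof -
  have "(\<lambda>z\<in>unit_disc. f z) holomorphic_on unit_disc"
    using assms(1) by (rule holomorphic_transform) simp
  moreover have "bounded ((\<lambda>z\<in>unit_disc. f z) ` unit_disc)"
    using assms(2) by (intro boundedI[of _ M]) auto
  ultimately show ?thesis by (simp add: H_infinity_def disc_fun_ring_def)
qed

lemma N_ring_holomorphic: "f \<in> carrier (N_ring p) \<Longrightarrow> f holomorphic_on unit_disc"
  and N_ring_extensional: "f \<in> carrier (N_ring p) \<Longrightarrow> f \<in> extensional unit_disc"
  by (auto simp: N_ring_def disc_fun_ring_def)

lemma exp_Lp_positive_in_N_ring:
  assumes "1 < p" "Lp_positive p G"
  shows "(\<lambda>z\<in>unit_disc. exp (G z)) \<in> carrier (N_ring p)"
  by (rule outer_function_in_N_ring[OF assms(1) Lp_positive_outer[OF assms]])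

lemma exp_minus_Lp_positive_in_H_infinity:
  assumes "Lp_positive p G"
  shows "(\<lambda>z\<in>unit_disc. exp (- G z)) \<in> carrier H_infinity"
  using assms by (intro in_H_infinityI[where M = 1] holomorphic_intros) (auto simp: Lp_positive_def)

text \<open>
  \<open>N\<^sup>p\<close> is a ring of fractions over \<open>H\<^sup>\<infinity>\<close> with denominators \<open>exp (- G)\<close>.
\<close>

lemma N_ring_quotient:
  assumes p: "1 < p" and f: "f \<in> carrier (N_ring p)"
  obtains G where "Lp_positive p G" "(\<lambda>z\<in>unit_disc. f z * exp (- G z)) \<in> carrier H_infinity"
proof -
  obtain G where G: "Lp_positive p G" "\<And>z. z \<in> unit_disc \<Longrightarrow> cmod (f z) \<le> exp (Re (G z))"
    using N_ring_majorant[OF p f] by blast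
  show thesis
  proof (rule that[OF G(1)], rule in_H_infinityI[where M = 1])
    show "(\<lambda>z. f z * exp (- G z)) holomorphic_on unit_disc"
      using G(1) by (intro holomorphic_intros N_ring_holomorphic[OF f]) (auto simp: Lp_positive_def)
    fix z :: complex assume "z \<in> unit_disc"
    then have "cmod (f z) * exp (- Re (G z)) \<le> exp (Re (G z)) * exp (- Re (G z))"
      by (intro mult_right_mono G(2)) auto
    also have "\<dots> = 1" by (simp flip: exp_add)
    finally show "cmod (f z * exp (- G z)) \<le> 1" by (simp add: norm_mult)
  qed
qed

text \<open>
  For \<open>f exp G + g exp H\<close> bring both terms to the common denominator:
  the numerator \<open>f exp (- H) + g exp (- G)\<close> is in \<open>I\<close>. Multiplication by an element of \<open>N\<^sup>p\<close> is
  multiplication by a fraction.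
\<close>

lemma outer_multiples_ideal:
  assumes p: "1 < p" and I: "ideal I H_infinity"
  shows "ideal {\<lambda>z\<in>unit_disc. f z * exp (G z) |f G. f \<in> I \<and> Lp_positive p G} (N_ring p)" (is "ideal ?J _")
proof -
  interpret N: cring "N_ring p" by (rule cring_N_ring[OF p])
  interpret I: ideal I H_infinity by (rule I)
  have IH: "f \<in> carrier H_infinity" if "f \<in> I" for f using that I.a_subset by blast
  have IN: "f \<in> carrier (N_ring p)" if "f \<in> I" for f
    using IH[OF that] carrier_H_infinity_subset_N_ring[OF p] by blast
  show ?thesis
  proof (rule N.ideal_if_closed)
    show "?J \<subseteq> carrier (N_ring p)"
    proof clarify
      fix f G assume f: "f \<in> I" and G: "Lp_positive p G"
      have "f \<otimes>\<^bsub>N_ring p\<^esub> (\<lambda>z\<in>unit_disc. exp (G z)) \<in> carrier (N_ring p)"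
        by (intro N.m_closed IN f exp_Lp_positive_in_N_ring p G)
      then show "(\<lambda>z\<in>unit_disc. f z * exp (G z)) \<in> carrier (N_ring p)"
        by (simp add: mult_N_ring cong: restrict_cong)
    qed
    have "(\<lambda>z\<in>unit_disc. \<zero>\<^bsub>H_infinity\<^esub> z * exp ((\<lambda>_. 0) z)) \<in> ?J"
      by (intro CollectI exI[of _ "\<zero>\<^bsub>H_infinity\<^esub>"] exI[of _ "\<lambda>_. 0"] conjI refl
          additive_subgroup.zero_closed[OF ideal.axioms(1)[OF I]] Lp_positive_0)
    then show "?J \<noteq> {}" by (metis emptyE)
    show "x \<oplus>\<^bsub>N_ring p\<^esub> y \<in> ?J" if "x \<in> ?J" "y \<in> ?J" for x y
    proof -
      obtain f G where x: "x = (\<lambda>z\<in>unit_disc. f z * exp (G z))" "f \<in> I" "Lp_positive p G" using \<open>x \<in> ?J\<close> by blast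
      obtain g H where y: "y = (\<lambda>z\<in>unit_disc. g z * exp (H z))" "g \<in> I" "Lp_positive p H" using \<open>y \<in> ?J\<close> by blast
      define h where "h = ((\<lambda>z\<in>unit_disc. exp (- H z)) \<otimes>\<^bsub>H_infinity\<^esub> f)
          \<oplus>\<^bsub>H_infinity\<^esub> ((\<lambda>z\<in>unit_disc. exp (- G z)) \<otimes>\<^bsub>H_infinity\<^esub> g)"
      have "h \<in> I" unfolding h_def
        using x y by (intro additive_subgroup.a_closed[OF ideal.axioms(1)[OF I]] I.I_l_closed exp_minus_Lp_positive_in_H_infinity)
      moreover have "Lp_positive p (\<lambda>z. G z + H z)" using x y p by (intro Lp_positive_add)
      moreover have "x \<oplus>\<^bsub>N_ring p\<^esub> y = (\<lambda>z\<in>unit_disc. h z * exp (G z + H z))"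
      proof
        fix z
        have "exp (G z) = exp (- H z) * exp (G z + H z)" "exp (H z) = exp (- G z) * exp (G z + H z)"
          by (simp_all flip: exp_add)
        then have "f z * exp (G z) + g z * exp (H z) = (exp (- H z) * f z + exp (- G z) * g z) * exp (G z + H z)"
          by (metis distrib_right mult.assoc mult.commute)
        then show "(x \<oplus>\<^bsub>N_ring p\<^esub> y) z = (\<lambda>z\<in>unit_disc. h z * exp (G z + H z)) z"
          by (simp add: x(1) y(1) h_def add_N_ring add_H_infinity mult_H_infinity)
      qed
      ultimately show ?thesis
        by (intro CollectI exI[of _ h] exI[of _ "\<lambda>z. G z + H z"] conjI)
    qed
    show "a \<otimes>\<^bsub>N_ring p\<^esub> x \<in> ?J" if a: "a \<in> carrier (N_ring p)" and "x \<in> ?J" for a x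
    proof -
      obtain f G where x: "x = (\<lambda>z\<in>unit_disc. f z * exp (G z))" "f \<in> I" "Lp_positive p G" using \<open>x \<in> ?J\<close> by blast
      obtain H where H: "Lp_positive p H" "(\<lambda>z\<in>unit_disc. a z * exp (- H z)) \<in> carrier H_infinity"
        using N_ring_quotient[OF p a] by blast
      define h where "h = (\<lambda>z\<in>unit_disc. a z * exp (- H z)) \<otimes>\<^bsub>H_infinity\<^esub> f"
      have "h \<in> I" unfolding h_def using x H by (intro I.I_l_closed)
      moreover have "Lp_positive p (\<lambda>z. H z + G z)" using x H p by (intro Lp_positive_add)
      moreover have "a \<otimes>\<^bsub>N_ring p\<^esub> x = (\<lambda>z\<in>unit_disc. h z * exp (H z + G z))"
      proof
        fix z
        have "a z * (f z * exp (G z)) = a z * exp (- H z) * f z * exp (H z + G z)"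
          by (simp add: exp_add exp_minus)
        then show "(a \<otimes>\<^bsub>N_ring p\<^esub> x) z = (\<lambda>z\<in>unit_disc. h z * exp (H z + G z)) z"
          by (simp add: x(1) h_def mult_N_ring mult_H_infinity)
      qed
      ultimately show ?thesis
        by (intro CollectI exI[of _ h] exI[of _ "\<lambda>z. H z + G z"] conjI)
    qed
  qed
qed

text \<open>
  Clearing the denominator of an element of \<open>J\<close> yields an element of the trace, and dividing by it
  again only multiplies by an element of \<open>N\<^sup>p\<close>.
\<close>

lemma ideal_eq_genideal_trace:
  assumes p: "1 < p" and J: "ideal J (N_ring p)"
  shows "J = genideal (N_ring p) (J \<inter> carrier H_infinity)"
proof
  interpret N: cring "N_ring p" by (rule cring_N_ring[OF p])
  interpret J: ideal J "N_ring p" by (rule J)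
  let ?I = "J \<inter> carrier H_infinity"
  have IN: "?I \<subseteq> carrier (N_ring p)" using carrier_H_infinity_subset_N_ring[OF p] by blast
  interpret gen: ideal "genideal (N_ring p) ?I" "N_ring p" by (rule N.genideal_ideal[OF IN])
  show "genideal (N_ring p) ?I \<subseteq> J" by (rule N.genideal_minimal[OF J]) blast
  show "J \<subseteq> genideal (N_ring p) ?I"
  proof
    fix f assume f: "f \<in> J"
    then have fN: "f \<in> carrier (N_ring p)" using J.a_subset by blast
    obtain G where G: "Lp_positive p G" "(\<lambda>z\<in>unit_disc. f z * exp (- G z)) \<in> carrier H_infinity"
      using N_ring_quotient[OF p fN] by blast
    define a where "a = (\<lambda>z\<in>unit_disc. f z * exp (- G z))"
    have "f \<otimes>\<^bsub>N_ring p\<^esub> (\<lambda>z\<in>unit_disc. exp (- G z)) \<in> J"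
      using exp_minus_Lp_positive_in_H_infinity[OF G(1)] carrier_H_infinity_subset_N_ring[OF p]
      by (intro J.I_r_closed f) blast
    moreover have "f \<otimes>\<^bsub>N_ring p\<^esub> (\<lambda>z\<in>unit_disc. exp (- G z)) = a"
      by (auto simp: a_def mult_N_ring)
    ultimately have "a \<in> ?I" using G(2) by (simp add: a_def)
    then have "a \<in> genideal (N_ring p) ?I" using N.genideal_self[OF IN] by blast
    then have "a \<otimes>\<^bsub>N_ring p\<^esub> (\<lambda>z\<in>unit_disc. exp (G z)) \<in> genideal (N_ring p) ?I"
      by (intro gen.I_r_closed exp_Lp_positive_in_N_ring p G)
    moreover have "a \<otimes>\<^bsub>N_ring p\<^esub> (\<lambda>z\<in>unit_disc. exp (G z)) = f"
    proof (rule extensionalityI)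
      show "f \<in> extensional unit_disc" by (rule N_ring_extensional[OF fN])
    qed (auto simp: a_def mult_N_ring exp_minus)
    ultimately show "f \<in> genideal (N_ring p) ?I" by simp
  qed
qed

theorem theorem1:
  fixes p :: real and I :: "(complex \<Rightarrow> complex) set"
  assumes "1 < p" and "ideal I H_infinity"
  shows "((\<exists>J. ideal J (N_ring p) \<and> I = J \<inter> carrier H_infinity) \<longleftrightarrow>
           (\<forall>f F. f \<in> I \<and> outer_function F \<and>
                  in_Lp p circle_measure (\<lambda>t. ln (cmod (radial_boundary F t))) \<and>
                  (\<lambda>z\<in>unit_disc. f z * F z) \<in> carrier H_infinity
              \<longrightarrow> (\<lambda>z\<in>unit_disc. f z * F z) \<in> I)) \<and>
         (\<forall>J. ideal J (N_ring p) \<and> I = J \<inter> carrier H_infinity \<longrightarrow>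
           (\<forall>J'. ideal J' (N_ring p) \<and> I = J' \<inter> carrier H_infinity \<longrightarrow> J' = J) \<and>
           J = genideal (N_ring p) I)"
proof (intro conjI allI impI iffI; (elim exE conjE)?)
  note p = assms(1)
  fix f F J
  assume J: "ideal J (N_ring p)" "I = J \<inter> carrier H_infinity" and f: "f \<in> I" and F: "outer_function F"
    "in_Lp p circle_measure (\<lambda>t. ln (cmod (radial_boundary F t)))"
    and fF: "(\<lambda>z\<in>unit_disc. f z * F z) \<in> carrier H_infinity"
  interpret J: ideal J "N_ring p" by (rule J(1))
  have "f \<otimes>\<^bsub>N_ring p\<^esub> (\<lambda>z\<in>unit_disc. F z) \<in> J"
    using f J(2) by (intro J.I_r_closed outer_function_in_N_ring p F) auto
  then have "(\<lambda>z\<in>unit_disc. f z * F z) \<in> J" by (simp add: mult_N_ring cong: restrict_cong)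
  with fF J(2) show "(\<lambda>z\<in>unit_disc. f z * F z) \<in> I" by simp
next
  note p = assms(1)
  assume cond: "\<forall>f F. f \<in> I \<and> outer_function F \<and>
                  in_Lp p circle_measure (\<lambda>t. ln (cmod (radial_boundary F t))) \<and>
                  (\<lambda>z\<in>unit_disc. f z * F z) \<in> carrier H_infinity
              \<longrightarrow> (\<lambda>z\<in>unit_disc. f z * F z) \<in> I"
  interpret I: ideal I H_infinity by (rule assms(2))
  let ?J = "{\<lambda>z\<in>unit_disc. f z * exp (G z) |f G. f \<in> I \<and> Lp_positive p G}"
  have "I = ?J \<inter> carrier H_infinity"
  proof (intro equalityI subsetI)
    fix f assume f: "f \<in> I"
    then have fH: "f \<in> carrier H_infinity" using I.a_subset by blast
    then have "f \<in> extensional unit_disc" by (simp add: H_infinity_def disc_fun_ring_def)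
    then have "f = (\<lambda>z\<in>unit_disc. f z * exp ((\<lambda>_. 0) z))" by (simp add: extensional_restrict)
    with f fH Lp_positive_0[of p] show "f \<in> ?J \<inter> carrier H_infinity"
      by (intro IntI CollectI exI[of _ f] exI[of _ "\<lambda>_. 0"]) auto
  next
    fix h assume h: "h \<in> ?J \<inter> carrier H_infinity"
    then obtain f G where "h = (\<lambda>z\<in>unit_disc. f z * exp (G z))" "f \<in> I" "Lp_positive p G" by blast
    with h show "h \<in> I" using cond Lp_positive_outer[OF p, of G] by auto
  qed
  with outer_multiples_ideal[OF p assms(2)]
  show "\<exists>J. ideal J (N_ring p) \<and> I = J \<inter> carrier H_infinity" by blast
next
  fix J J' assume "ideal J (N_ring p)" "I = J \<inter> carrier H_infinity" "ideal J' (N_ring p)" "I = J' \<inter> carrier H_infinity"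
  then show "J' = J"
    using ideal_eq_genideal_trace[OF assms(1), of J] ideal_eq_genideal_trace[OF assms(1), of J'] by simp
next
  fix J assume "ideal J (N_ring p)" "I = J \<inter> carrier H_infinity"
  then show "J = genideal (N_ring p) I"
    using ideal_eq_genideal_trace[OF assms(1), of J] by simp
qed

end
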